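(* Let $(X,\phi)$ be a cw-expansive flow without fixed points defined on a Peano continuum $X$ which is not a circle. Then there are no stable points for $\phi_t$ and there are no stable points for $\phi_{-t}$; that is, no $x\in X$ satisfies "for each $\varepsilon>0$ there is $\delta>0$ with $H_\delta(x)\subset T^s_\varepsilon(x)$", and no $x\in X$ satisfies "for each $\varepsilon>0$ there is $\delta>0$ with $H_\delta(x)\subset T^u_\varepsilon(x)$".
   Context: $(X,d)$ is a compact metric space and $\phi:\mathbb{R}\times X\to X$, $\phi(t,x)=\phi_t(x)$, is a continuous flow without fixed points (for every $x$ there is $t$ with $\phi_t(x)\ne x$). A continuum is a nonempty compact connected set; a Peano continuum is a locally connected continuum (metrizable). $\mathcal{K}(X)$ is the set of nonempty compact subsets of $X$, $\mathcal{C}(X)$ the set of subcontinua of $X$, and $B_\rho(x)=\{y: d(x,y)\le\rho\}$. "Circle" means homeomorphic to $S^1$. Fixed field of transversal sections: a map $H:X\to\mathcal{K}(X)$ with $x\in H(x)$ and constants $\tau>0$, $r>0$ such that for every $x\in X$ the map $[-\tau,\tau]\times H(x)\to X$, $(t,y)\mapsto\phi_t(y)$, is injective and $B_r(x)\subset\phi_{[-\tau,\tau]}(H(x))$. It is symmetric ($y\in H(x)$ iff $x\in H(y)$), monotone (there is $\kappa>0$ with $H(x)\cap H(\phi_t(x))=\emptyset$ for all $x\in X$, $t\in(0,\kappa)$), and its graph $\{(x,y): y\in H(x)\}$ is closed. Put $H_\varepsilon(x)=H(x)\cap B_\varepsilon(x)$. $Rep(\mathbb{R})$ is the set of increasing homeomorphisms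 $h:\mathbb{R}\to\mathbb{R}$ with $h(0)=0$; $Rep(\mathbb{R})^+$ and $Rep(\mathbb{R})^-$ are the sets of their restrictions to $[0,\infty)$ and $(-\infty,0]$. Then $T^s_\varepsilon(x)=\{y\in X: \exists\,\alpha\in Rep(\mathbb{R})^+,\ \phi_{\alpha(t)}(y)\in H_\varepsilon(\phi_t(x))\ \forall t\ge0\}$ and $T^u_\varepsilon(x)=\{y\in X: \exists\,\alpha\in Rep(\mathbb{R})^-,\ \phi_{\alpha(t)}(y)\in H_\varepsilon(\phi_t(x))\ \forall t\le0\}$. A point $x$ is stable (for $\phi_t$) if for each $\varepsilon>0$ there is $\delta>0$ with $H_\delta(x)\subset T^s_\varepsilon(x)$. For $A\subset X$, $\mathcal{H}(A)$ is the set of maps $\alpha$ assigning to each $y\in A$ a continuous function $\alpha(y):\mathbb{R}\to\mathbb{R}$ with $\alpha(y)(0)=0$, such that $\alpha(x_\alpha)=\mathrm{id}$ for some $x_\alpha\in A$ and, for every $t$, $y\mapsto\alpha(y)(t)$ is continuous on $A$. Put $\mathcal{X}^t_\alpha(A)=\{\phi_{\alpha(y)(t)}(y): y\in A\}$. $\phi$ is cw-expansive if for every $\eta>0$ there is $\delta>0$ such that if $A\in\mathcal{C}(X)$, $\alpha\in\mathcal{H}(A)$ and $\operatorname{diam}(\mathcal{X}^t_\alpha(A))\le\delta$ for every $t\in\mathbb{R}$, then $A\subset\phi_{(-\eta,\eta)}(x_\alpha)$. *)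

theory Defs
  imports "HOL-Analysis.Analysis"
begin

text \<open>The phase space is the whole type \<open>'a\<close> with its metric; compactness and
  connectedness are assumptions on \<open>UNIV\<close>.\<close>

definition continuum :: "'a::metric_space set \<Rightarrow> bool" where
  "continuum A \<longleftrightarrow> A \<noteq> {} \<and> compact A \<and> connected A"

definition peano_continuum :: "'a::metric_space set \<Rightarrow> bool" where
  "peano_continuum A \<longleftrightarrow> continuum A \<and> locally connected A"

definition continuous_flow :: "(real \<Rightarrow> 'a::metric_space \<Rightarrow> 'a) \<Rightarrow> bool" where
  "continuous_flow \<phi> \<longleftrightarrow>
     continuous_on UNIV (\<lambda>(t, x). \<phi> t x) \<and>
     (\<forall>x. \<phi> 0 x = x) \<and>
     (\<forall>s t x. \<phi> (s + t) x = \<phi> s (\<phi> t x))"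

definition no_fixed_points :: "(real \<Rightarrow> 'a::metric_space \<Rightarrow> 'a) \<Rightarrow> bool" where
  "no_fixed_points \<phi> \<longleftrightarrow> (\<forall>x. \<exists>t. \<phi> t x \<noteq> x)"

definition field_of_sections ::
    "(real \<Rightarrow> 'a::metric_space \<Rightarrow> 'a) \<Rightarrow> ('a \<Rightarrow> 'a set) \<Rightarrow> bool" where
  "field_of_sections \<phi> H \<longleftrightarrow>
     (\<forall>x. compact (H x) \<and> x \<in> H x) \<and>
     (\<exists>\<tau>>0. \<exists>r>0. \<forall>x.
        inj_on (\<lambda>(t, y). \<phi> t y) ({-\<tau>..\<tau>} \<times> H x) \<and>
        cball x r \<subseteq> (\<lambda>(t, y). \<phi> t y) ` ({-\<tau>..\<tau>} \<times> H x))"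

definition symmetric_field :: "('a \<Rightarrow> 'a set) \<Rightarrow> bool" where
  "symmetric_field H \<longleftrightarrow> (\<forall>x y. y \<in> H x \<longleftrightarrow> x \<in> H y)"

definition monotone_field ::
    "(real \<Rightarrow> 'a::metric_space \<Rightarrow> 'a) \<Rightarrow> ('a \<Rightarrow> 'a set) \<Rightarrow> bool" where
  "monotone_field \<phi> H \<longleftrightarrow> (\<exists>\<kappa>>0. \<forall>x. \<forall>t\<in>{0<..<\<kappa>}. H x \<inter> H (\<phi> t x) = {})"

definition closed_graph_field :: "('a::metric_space \<Rightarrow> 'a set) \<Rightarrow> bool" where
  "closed_graph_field H \<longleftrightarrow> closed {(x, y). y \<in> H x}"

definition local_section :: "('a::metric_space \<Rightarrow> 'a set) \<Rightarrow> real \<Rightarrow> 'a \<Rightarrow> 'a set" where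
  "local_section H \<epsilon> x = H x \<inter> cball x \<epsilon>"

definition Rep :: "(real \<Rightarrow> real) set" where
  "Rep = {h. strict_mono h \<and> (\<exists>g. homeomorphism UNIV UNIV h g) \<and> h 0 = 0}"

definition Rep_plus :: "(real \<Rightarrow> real) set" where
  "Rep_plus = (\<lambda>h. restrict h {0..}) ` Rep"

definition Rep_minus :: "(real \<Rightarrow> real) set" where
  "Rep_minus = (\<lambda>h. restrict h {..0}) ` Rep"

definition stable_set ::
    "(real \<Rightarrow> 'a::metric_space \<Rightarrow> 'a) \<Rightarrow> ('a \<Rightarrow> 'a set) \<Rightarrow> real \<Rightarrow> 'a \<Rightarrow> 'a set" where
  "stable_set \<phi> H \<epsilon> x =
     {y. \<exists>\<alpha>\<in>Rep_plus. \<forall>t\<ge>0. \<phi> (\<alpha> t) y \<in> local_section H \<epsilon> (\<phi> t x)}"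

definition unstable_set ::
    "(real \<Rightarrow> 'a::metric_space \<Rightarrow> 'a) \<Rightarrow> ('a \<Rightarrow> 'a set) \<Rightarrow> real \<Rightarrow> 'a \<Rightarrow> 'a set" where
  "unstable_set \<phi> H \<epsilon> x =
     {y. \<exists>\<alpha>\<in>Rep_minus. \<forall>t\<le>0. \<phi> (\<alpha> t) y \<in> local_section H \<epsilon> (\<phi> t x)}"

definition stable_point ::
    "(real \<Rightarrow> 'a::metric_space \<Rightarrow> 'a) \<Rightarrow> ('a \<Rightarrow> 'a set) \<Rightarrow> 'a \<Rightarrow> bool" where
  "stable_point \<phi> H x \<longleftrightarrow> (\<forall>\<epsilon>>0. \<exists>\<delta>>0. local_section H \<delta> x \<subseteq> stable_set \<phi> H \<epsilon> x)"

text \<open>Stability of \<open>x\<close> for the reversed flow \<open>\<lambda>t. \<phi> (-t)\<close>, expressed through the unstable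
  sets of \<open>\<phi>\<close>.\<close>

definition reverse_stable_point ::
    "(real \<Rightarrow> 'a::metric_space \<Rightarrow> 'a) \<Rightarrow> ('a \<Rightarrow> 'a set) \<Rightarrow> 'a \<Rightarrow> bool" where
  "reverse_stable_point \<phi> H x \<longleftrightarrow> (\<forall>\<epsilon>>0. \<exists>\<delta>>0. local_section H \<delta> x \<subseteq> unstable_set \<phi> H \<epsilon> x)"

text \<open>The maps \<open>\<alpha>\<close> live on all of \<open>'a\<close>, but only their values on \<open>A\<close> are constrained or used.\<close>

definition time_changes :: "'a::metric_space set \<Rightarrow> ('a \<Rightarrow> real \<Rightarrow> real) set" where
  "time_changes A =
     {\<alpha>. (\<forall>y\<in>A. continuous_on UNIV (\<alpha> y) \<and> \<alpha> y 0 = 0) \<and>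
         (\<exists>x\<in>A. \<alpha> x = id) \<and>
         (\<forall>t. continuous_on A (\<lambda>y. \<alpha> y t))}"

definition moved_set ::
    "(real \<Rightarrow> 'a::metric_space \<Rightarrow> 'a) \<Rightarrow> ('a \<Rightarrow> real \<Rightarrow> real) \<Rightarrow> real \<Rightarrow> 'a set \<Rightarrow> 'a set" where
  "moved_set \<phi> \<alpha> t A = (\<lambda>y. \<phi> (\<alpha> y t) y) ` A"

text \<open>The base point \<open>x\<close> of \<open>\<alpha>\<close> need not be unique; the conclusion is required for every
  choice. Requiring it for one choice gives an equivalent notion: if \<open>A\<close> lies in the
  \<open>\<eta>\<close>-orbit segment of one base point, then it lies in the \<open>2\<eta>\<close>-orbit segment of any point
  of \<open>A\<close>.\<close>

definition cw_expansive :: "(real \<Rightarrow> 'a::metric_space \<Rightarrow> 'a) \<Rightarrow> bool" where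
  "cw_expansive \<phi> \<longleftrightarrow>
     (\<forall>\<eta>>0. \<exists>\<delta>>0. \<forall>A. \<forall>\<alpha>\<in>time_changes A. \<forall>x\<in>A.
        continuum A \<and> \<alpha> x = id \<and> (\<forall>t. diameter (moved_set \<phi> \<alpha> t A) \<le> \<delta>)
        \<longrightarrow> A \<subseteq> (\<lambda>t. \<phi> t x) ` {-\<eta><..<\<eta>})"

end

theory Submission
  imports Defs
begin

text \<open>
  Section times turn the flow into a discrete holonomy: over a sequence \<open>u\<close> of base points that is
  a pseudo-orbit, a point of the section at \<open>u 0\<close> is carried to the sections at \<open>u 1, u 2, \<dots>\<close> and
  \<open>u (-1), u (-2), \<dots>\<close>. By cw-expansiveness a continuum that stays close to a bi-infinite
  pseudo-orbit is a point, so by compactness a continuum that stays close to \<open>u\<close> in forward time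
  contracts at a rate independent of \<open>u\<close>.

  If \<open>x\<close> is stable, local connectedness and this contraction give a radius at which all points
  \<open>\<phi> (-n) x\<close>, for large \<open>n\<close>, are stable with one and the same \<open>\<epsilon>\<close>. Two of these points that are
  close to each other and far apart in time give a contracting first return map of a neighbourhood
  in a section into itself, hence a periodic orbit that attracts the neighbourhood. The backward
  orbit of \<open>x\<close> visits the neighbourhood infinitely often, so \<open>x\<close> lies on the periodic orbit.
  Every point of the neighbourhood is itself stable and hence periodic, and it is attracted by the
  same periodic orbit, so it lies on it. The orbit is therefore open and closed, and \<open>X\<close> is a circle.
  The second claim is the first one for the reversed flow.
\<close>

subsection \<open>Connectedness in compact metric spaces\<close>

text \<open>Free reparametrisation is the obstacle: stability and cw-expansiveness both let each
  orbit run in its own time. A nearby orbit meets a section at only one time in a short interval, so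
  following it from section to section fixes the time, and the remaining data are discrete.
  Cw-expansiveness controls connected sets only, while a small ball in a section may be
  disconnected. Every estimate is therefore made for a continuum; local connectedness supplies those
  that contain a neighbourhood. Base sequences are pseudo-orbits rather than orbits because the
  return map lives over an orbit segment closed up by a small jump. Allowing arbitrary sequences
  also makes the space of bases compact, and this gives contraction times independent of the base.
  The contraction has no factor: it only says that the image has diameter at most
  \<open>\<sigma>\<close> after \<open>N\<close> steps. The fixed point of the return map is
  accordingly found by minimising the displacement, not by Banach's theorem.\<close>

lemma diameter_le_dist:
  fixes A :: "'a::metric_space set"
  assumes "0 \<le> \<delta>" and "\<And>x y. x \<in> A \<Longrightarrow> y \<in> A \<Longrightarrow> dist x y \<le> \<delta>"
  shows "diameter A \<le> \<delta>"
proof (cases "A = {}")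
  case False
  then have "(SUP (x,y)\<in>A\<times>A. dist x y) \<le> \<delta>"
    using assms(2) by (intro cSUP_least) auto
  then show ?thesis using False by (simp add: diameter_def)
qed (simp add: assms)

text \<open>The relatively clopen sets around \<open>b\<close> are closed under finite intersection,
  so by compactness one of them enters any given neighbourhood of \<open>Q\<close>. If
  \<open>Q\<close> split, such a set inside two disjoint open sets could be cut down to the half
  containing \<open>b\<close>, and the other half would not belong to \<open>Q\<close>. The last
  claim is what allows a strict estimate on \<open>Q\<close> to spread to a clopen set.\<close>

lemma quasi_component_connected:
  fixes D :: "'a::metric_space set"
  assumes "compact D" "b \<in> D"
  defines "Q \<equiv> \<Inter>{K. K \<subseteq> D \<and> closed K \<and> openin (top_of_set D) K \<and> b \<in> K}"
  shows "compact Q" "connected Q" "b \<in> Q" "Q \<subseteq> D"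
    "\<And>U. open U \<Longrightarrow> Q \<subseteq> U \<Longrightarrow>
      \<exists>K. K \<subseteq> D \<and> closed K \<and> openin (top_of_set D) K \<and> b \<in> K \<and> K \<subseteq> U"
proof -
  define F where "F = {K. K \<subseteq> D \<and> closed K \<and> openin (top_of_set D) K \<and> b \<in> K}"
  have QF: "Q = \<Inter>F" by (simp add: Q_def F_def)
  have DF: "D \<in> F" using assms by (auto simp: F_def compact_imp_closed)
  show bQ: "b \<in> Q" by (auto simp: QF F_def)
  show QD: "Q \<subseteq> D" using DF by (auto simp: QF)
  have "closed Q" unfolding QF by (rule closed_Inter) (auto simp: F_def)
  then show cQ: "compact Q"
    using QD assms(1) by (metis compact_Int_closed inf.absorb_iff2)
  have Fint: "K \<inter> L \<in> F" if "K \<in> F" "L \<in> F" for K L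
    using that by (auto simp: F_def)
  have nbhd: "\<exists>K\<in>F. K \<subseteq> U" if U: "open U" "Q \<subseteq> U" for U
  proof (rule ccontr)
    assume neg: "\<not> (\<exists>K\<in>F. K \<subseteq> U)"
    have fin: "\<Inter>G \<in> F" if "finite G" "G \<noteq> {}" "G \<subseteq> F" for G
      using that by (induction G rule: finite_ne_induct) (auto intro: Fint)
    have "(D \<inter> - U) \<inter> \<Inter>F \<noteq> {}"
    proof (rule compact_imp_fip)
      show "compact (D \<inter> - U)" using assms U by (auto intro: compact_Int_closed)
      show "closed T" if "T \<in> F" for T using that by (simp add: F_def)
      show "D \<inter> - U \<inter> \<Inter>G \<noteq> {}" if "finite G" "G \<subseteq> F" for G
      proof -
        have "\<Inter>(insert D G) \<in> F" using that DF by (intro fin) auto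
        then have "\<not> \<Inter>(insert D G) \<subseteq> U" using neg by blast
        then show ?thesis by auto
      qed
    qed
    then show False using U QF by auto
  qed
  show "\<exists>K. K \<subseteq> D \<and> closed K \<and> openin (top_of_set D) K \<and> b \<in> K \<and> K \<subseteq> U"
    if "open U" "Q \<subseteq> U" for U
    using nbhd[OF that] by (auto simp: F_def)
  show "connected Q"
    unfolding connected_closedin_eq
  proof (rule notI, elim exE conjE)
    fix A B assume AB: "closedin (top_of_set Q) A" "closedin (top_of_set Q) B"
      "A \<union> B = Q" "A \<inter> B = {}" "A \<noteq> {}" "B \<noteq> {}"
    have *: False if ab: "b \<in> A" "closedin (top_of_set Q) A" "closedin (top_of_set Q) B"
      "Q = A \<union> B" "A \<inter> B = {}" "B \<noteq> {}" for A B
    proof -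
      have cl: "closed A" "closed B"
        using ab \<open>closed Q\<close> closedin_closed_trans by blast+
      obtain U V where UV: "open U" "open V" "A \<subseteq> U" "B \<subseteq> V" "U \<inter> V = {}"
        using t4_space[OF cl ab(5)] by blast
      obtain K where K: "K \<in> F" "K \<subseteq> U \<union> V"
        using nbhd[of "U \<union> V"] UV ab(4) by auto
      have "K \<inter> U = K \<inter> - V" using K UV by auto
      then have "closed (K \<inter> U)" using K UV by (auto simp: F_def intro: closed_Int)
      moreover have "openin (top_of_set D) (K \<inter> U)"
        using K UV by (auto simp: F_def openin_Int_open)
      ultimately have "K \<inter> U \<in> F" using K ab UV by (auto simp: F_def)
      then have "Q \<subseteq> U" using QF by auto
      then show False using ab(4,6) UV(4,5) by blast
    qed
    show False
    proof (cases "b \<in> A")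
      case True then show ?thesis using *[OF _ AB(1,2) AB(3)[symmetric] AB(4,6)] by blast
    next
      case False
      then have "b \<in> B" using bQ AB by auto
      then show ?thesis using *[OF _ AB(2,1) _ _ AB(5)] AB by (metis Un_commute Int_commute)
    qed
  qed
qed

text \<open>A substitute for Hausdorff limits that needs no convergence of the sets. A separation of
  the upper limit by open sets \<open>U\<close>, \<open>V\<close> eventually covers
  \<open>A k\<close>; the convergent points \<open>x k\<close> lie in one side, while infinitely
  many \<open>A k\<close> reach the other.\<close>

lemma limsup_connected:
  fixes A :: "nat \<Rightarrow> 'a::metric_space set"
  assumes comp: "compact (UNIV :: 'a set)" and conn: "\<And>n. connected (A n)"
    and x: "\<And>n. x n \<in> A n" "x \<longlonglongrightarrow> l"
  shows "connected (\<Inter>M. closure (\<Union>n\<in>{M..}. A n))" (is "connected ?L")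
proof -
  have clL: "closed ?L" by auto
  have mem: "\<exists>k\<ge>M. A k \<inter> U \<noteq> {}" if "z \<in> ?L" "open U" "z \<in> U" for z U M
  proof -
    have "z \<in> closure (\<Union>n\<in>{M..}. A n)" using that by auto
    then have "U \<inter> (\<Union>n\<in>{M..}. A n) \<noteq> {}"
      using that by (metis IntI empty_iff open_Int_closure_eq_empty)
    then show ?thesis by auto
  qed
  have lL: "l \<in> ?L"
  proof
    fix M
    have "x n \<in> closure (\<Union>n\<in>{M..}. A n)" if "n \<ge> M" for n
      using x(1)[of n] that by (intro subsetD[OF closure_subset]) auto
    then have "eventually (\<lambda>n. x n \<in> closure (\<Union>n\<in>{M..}. A n)) sequentially"
      unfolding eventually_sequentially by blast
    then show "l \<in> closure (\<Union>n\<in>{M..}. A n)"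
      by (rule Lim_in_closed_set[OF closed_closure _ trivial_limit_sequentially x(2)])
  qed
  have ev: "\<exists>M. \<forall>n\<ge>M. A n \<subseteq> U" if "open U" "?L \<subseteq> U" for U
  proof (rule ccontr)
    assume neg: "\<not> (\<exists>M. \<forall>n\<ge>M. A n \<subseteq> U)"
    have "(- U) \<inter> \<Inter>(range (\<lambda>M. closure (\<Union>n\<in>{M..}. A n))) \<noteq> {}"
    proof (rule compact_imp_fip)
      show "compact (- U)" using comp that by (metis closed_Compl compact_Int_closed inf_top_left)
      show "closed T" if "T \<in> range (\<lambda>M. closure (\<Union>n\<in>{M..}. A n))" for T using that by auto
      fix G assume G: "finite G" "G \<subseteq> range (\<lambda>M. closure (\<Union>n\<in>{M..}. A n))"
      then obtain I where I: "finite I" "G = (\<lambda>M. closure (\<Union>n\<in>{M..}. A n)) ` I"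
        by (meson finite_subset_image)
      then obtain m where m: "\<forall>i\<in>I. i \<le> m" using finite_nat_set_iff_bounded_le by auto
      obtain n y where n: "n \<ge> m" "y \<in> A n" "y \<notin> U" using neg by blast
      have "y \<in> closure (\<Union>n\<in>{i..}. A n)" if "i \<in> I" for i
        using n m that by (intro subsetD[OF closure_subset]) force
      then show "- U \<inter> \<Inter>G \<noteq> {}" using n I by auto
    qed
    then show False using that by auto
  qed
  show ?thesis
    unfolding connected_closedin_eq
  proof (rule notI, elim exE conjE)
    fix C B assume AB: "closedin (top_of_set ?L) C" "closedin (top_of_set ?L) B"
      "C \<union> B = ?L" "C \<inter> B = {}" "C \<noteq> {}" "B \<noteq> {}"
    have *: False if ab: "l \<in> C" "closedin (top_of_set ?L) C" "closedin (top_of_set ?L) B"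
      "?L = C \<union> B" "C \<inter> B = {}" "B \<noteq> {}" for C B
    proof -
      have cl: "closed C" "closed B"
        using ab clL closedin_closed_trans by blast+
      obtain U V where UV: "open U" "open V" "C \<subseteq> U" "B \<subseteq> V" "U \<inter> V = {}"
        using t4_space[OF cl ab(5)] by blast
      obtain M where M: "\<forall>n\<ge>M. A n \<subseteq> U \<union> V"
        using ev[of "U \<union> V"] UV ab(4) by auto
      have "eventually (\<lambda>n. x n \<in> U) sequentially"
        using topological_tendstoD[OF x(2) UV(1)] UV ab(1) by blast
      then obtain M' where M': "\<forall>n\<ge>M'. x n \<in> U" by (auto simp: eventually_sequentially)
      obtain z where z: "z \<in> B" using ab by auto
      have zL: "z \<in> ?L" and zV: "z \<in> V" using z ab(4) UV(4) by auto
      obtain k where k: "k \<ge> max M M'" "A k \<inter> V \<noteq> {}"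
        using mem[OF zL UV(2) zV, of "max M M'"] by (elim exE conjE)
      have "U \<inter> A k = {} \<or> V \<inter> A k = {}"
      proof (rule connectedD[OF conn UV(1,2)])
        show "A k \<subseteq> U \<union> V" using M k(1) by simp
      qed (simp add: UV(5))
      moreover have "x k \<in> U" using M' k(1) by simp
      ultimately show False using k(2) x(1)[of k] by blast
    qed
    show False
    proof (cases "l \<in> C")
      case True then show ?thesis using *[OF _ AB(1,2) AB(3)[symmetric] AB(4,6)] by blast
    next
      case False
      then have "l \<in> B" using lL AB by auto
      then show ?thesis using *[OF _ AB(2,1) _ _ AB(5)] AB by (metis Un_commute Int_commute)
    qed
  qed
qed

text \<open>A Lebesgue number for a cover by small connected open sets. Closures are taken so that
  \<open>C\<close> is compact.\<close>

lemma uniformly_locally_connected: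
  assumes comp: "compact (UNIV :: 'a::metric_space set)" and loc: "locally connected (UNIV :: 'a set)"
    and e: "0 < e"
  obtains \<delta> where "0 < \<delta>"
    "\<And>x::'a. \<exists>C. connected C \<and> closed C \<and> cball x \<delta> \<subseteq> C \<and> C \<subseteq> cball x e"
proof -
  have "\<exists>W. open W \<and> connected W \<and> z \<in> W \<and> W \<subseteq> ball z (e/2)" for z :: 'a
    using loc[unfolded locally_connected, rule_format, of "ball z (e/2)" z] e by auto
  then obtain W where W: "\<And>z::'a. open (W z)" "\<And>z. connected (W z)" "\<And>z. z \<in> W z"
    "\<And>z. W z \<subseteq> ball z (e/2)" by metis
  obtain d where d: "0 < d" "\<And>x::'a. x \<in> UNIV \<Longrightarrow> \<exists>G\<in>range W. ball x d \<subseteq> G"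
    by (rule Heine_Borel_lemma[OF comp, of "range W"]) (use W in blast)+
  show ?thesis
  proof
    show "0 < d/2" using d by simp
    fix x :: 'a
    obtain z where z: "ball x d \<subseteq> W z" using d(2) by blast
    show "\<exists>C. connected C \<and> closed C \<and> cball x (d/2) \<subseteq> C \<and> C \<subseteq> cball x e"
    proof (intro exI conjI)
      show "connected (closure (W z))" using W connected_imp_connected_closure by blast
      show "cball x (d/2) \<subseteq> closure (W z)"
        using z d by (intro order_trans[OF _ closure_subset]) force
      have "x \<in> W z" using z d by auto
      then have "W z \<subseteq> cball x e" using W(4)[of z]
        using dist_triangle_half_r[of z x e] by (fastforce simp: subset_iff less_imp_le)
      then show "closure (W z) \<subseteq> cball x e" by (simp add: closure_minimal)
    qed auto
  qed
qed

subsection \<open>Holonomy along a pseudo-orbit\<close>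

text \<open>\<open>S x y\<close> is the time that carries \<open>y\<close> to the section at
  \<open>x\<close>. It is total and continuous, and meaningful when
  \<open>dist x y \<le> r0\<close>; thus the holonomy is continuous for every base and point without
  domain conditions. The bounds on \<open>\<tau>\<close> and \<open>S\<close> make each step last
  between \<open>7/8\<close> and \<open>9/8\<close>.\<close>

locale section_flow =
  fixes \<phi> :: "real \<Rightarrow> 'a::metric_space \<Rightarrow> 'a" and H :: "'a \<Rightarrow> 'a set"
    and S :: "'a \<Rightarrow> 'a \<Rightarrow> real" and \<tau> r0 \<rho> :: real
  assumes comp: "compact (UNIV :: 'a set)"
    and flow: "continuous_flow \<phi>"
    and self: "\<And>x. x \<in> H x"
    and graph: "closed_graph_field H"
    and cont_S: "continuous_on UNIV (\<lambda>(x, y). S x y)"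
    and tau: "0 < \<tau>" "\<tau> \<le> 1/2"
    and S_bound: "\<And>x y. \<bar>S x y\<bar> \<le> \<tau>/4"
    and r0: "0 < r0"
    and S_mem: "\<And>x y. dist x y \<le> r0 \<Longrightarrow> \<phi> (S x y) y \<in> H x"
    and unique: "\<And>x v e. v \<in> H x \<Longrightarrow> \<phi> e v \<in> H x \<Longrightarrow> \<bar>e\<bar> \<le> \<tau> \<Longrightarrow> e = 0"
    and rho: "0 < \<rho>" "\<rho> \<le> r0"
    and rho_step: "\<And>v w d. dist v w \<le> \<rho> \<Longrightarrow> d \<in> {1, -1} \<Longrightarrow> dist (\<phi> d v) (\<phi> d w) \<le> r0/2"
begin

lemma phi0 [simp]: "\<phi> 0 x = x"
  using flow by (simp add: continuous_flow_def)

lemma phi_add [simp]: "\<phi> s (\<phi> t x) = \<phi> (s + t) x"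
  using flow by (simp add: continuous_flow_def)

lemma cont_phi: "continuous_on UNIV (\<lambda>(t, x). \<phi> t x)"
  using flow by (simp add: continuous_flow_def)

lemma phi_tendsto:
  assumes "(f \<longlongrightarrow> s) F" "(g \<longlongrightarrow> x) F"
  shows "((\<lambda>i. \<phi> (f i) (g i)) \<longlongrightarrow> \<phi> s x) F"
  using continuous_on_tendsto_compose[OF cont_phi tendsto_Pair[OF assms]] by simp

lemma S_tendsto:
  assumes "(f \<longlongrightarrow> s) F" "(g \<longlongrightarrow> x) F"
  shows "((\<lambda>i. S (f i) (g i)) \<longlongrightarrow> S s x) F"
  using continuous_on_tendsto_compose[OF cont_S tendsto_Pair[OF assms]] by simp

lemma phi_continuous_on [continuous_intros]:
  assumes "continuous_on A f" "continuous_on A g"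
  shows "continuous_on A (\<lambda>i. \<phi> (f i) (g i))"
  using assms by (auto simp: continuous_on_def intro: phi_tendsto)

lemma S_continuous_on [continuous_intros]:
  assumes "continuous_on A f" "continuous_on A g"
  shows "continuous_on A (\<lambda>i. S (f i) (g i))"
  using assms by (auto simp: continuous_on_def intro: S_tendsto)

text \<open>Uniform continuity needs a compact set of times. The bound \<open>2\<close> exceeds one
  step of the holonomy, which lasts at most \<open>9/8\<close>.\<close>

lemma phi_uniform:
  assumes "0 < e"
  obtains \<delta> where "0 < \<delta>"
    "\<And>s s' v w. \<lbrakk>\<bar>s\<bar> \<le> 2; \<bar>s'\<bar> \<le> 2; \<bar>s - s'\<bar> \<le> \<delta>; dist v w \<le> \<delta>\<rbrakk> \<Longrightarrow> dist (\<phi> s v) (\<phi> s' w) \<le> e"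
proof -
  have "uniformly_continuous_on ({-2..2} \<times> UNIV) (\<lambda>(t, x). \<phi> t x)"
    by (intro compact_uniformly_continuous continuous_on_subset[OF cont_phi] compact_Times comp) auto
  then obtain d where d: "0 < d" "\<And>p q. \<lbrakk>p \<in> {-2..2} \<times> UNIV; q \<in> {-2..2} \<times> UNIV; dist q p < d\<rbrakk>
      \<Longrightarrow> dist (case q of (t, x) \<Rightarrow> \<phi> t x) (case p of (t, x) \<Rightarrow> \<phi> t x) < e"
    using assms unfolding uniformly_continuous_on_def by meson
  show ?thesis
  proof (rule that[of "d/3"])
    show "dist (\<phi> s v) (\<phi> s' w) \<le> e"
      if "\<bar>s\<bar> \<le> 2" "\<bar>s'\<bar> \<le> 2" "\<bar>s - s'\<bar> \<le> d/3" "dist v w \<le> d/3" for s s' v w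
    proof -
      have "dist (s, v) (s', w) \<le> \<bar>s - s'\<bar> + dist v w"
        using sqrt_sum_squares_le_sum_abs[of "s - s'" "dist v w"]
        by (simp add: dist_Pair_Pair dist_real_def)
      then show ?thesis using d(2)[of "(s',w)" "(s,v)"] that \<open>0 < d\<close> by (auto simp: abs_le_iff)
    qed
  qed (use d in simp)
qed

lemma S_uniform:
  assumes "0 < e"
  obtains \<delta> where "0 < \<delta>"
    "\<And>x y v w. \<lbrakk>dist x y \<le> \<delta>; dist v w \<le> \<delta>\<rbrakk> \<Longrightarrow> \<bar>S x v - S y w\<bar> \<le> e"
proof -
  have "compact (UNIV :: ('a \<times> 'a) set)"
    using compact_Times[OF comp comp] by simp
  then have "uniformly_continuous_on UNIV (\<lambda>(t, x). S t x)"
    using cont_S by (intro compact_uniformly_continuous)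
  then obtain d where d: "0 < d" "\<And>p q. dist q p < d
      \<Longrightarrow> dist (case q of (t, x) \<Rightarrow> S t x) (case p of (t, x) \<Rightarrow> S t x) < e"
    using assms unfolding uniformly_continuous_on_def by (meson UNIV_I)
  show ?thesis
  proof (rule that[of "d/3"])
    show "\<bar>S x v - S y w\<bar> \<le> e"
      if "dist x y \<le> d/3" "dist v w \<le> d/3" for x y v w
    proof -
      have "dist (x, v) (y, w) \<le> dist x y + dist v w"
        using sqrt_sum_squares_le_sum_abs[of "dist x y" "dist v w"]
        by (simp add: dist_Pair_Pair)
      then show ?thesis using d(2)[of "(x,v)" "(y,w)"] that \<open>0 < d\<close>
        by (auto simp: dist_real_def)
    qed
  qed (use d in simp)
qed

text \<open>The bound on \<open>e\<close> leaves \<open>\<tau>/4\<close> for \<open>S x y\<close>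
  within the range \<open>\<tau>\<close> of \<open>unique\<close>, and it admits a combination of
  three section times, as needed in \<open>base_change\<close>.\<close>

lemma S_unique:
  assumes "dist x y \<le> r0" "\<phi> e y \<in> H x" "\<bar>e\<bar> \<le> 3*\<tau>/4"
  shows "S x y = e"
proof -
  have "\<phi> (e - S x y) (\<phi> (S x y) y) \<in> H x" using assms by simp
  moreover have "\<bar>e - S x y\<bar> \<le> \<tau>" using S_bound[of x y] assms(3) by linarith
  ultimately have "e - S x y = 0" using unique[OF S_mem[OF assms(1)]] by blast
  then show ?thesis by simp
qed

lemma S_eq_0:
  assumes "y \<in> H x" "dist x y \<le> r0"
  shows "S x y = 0"
  using S_unique[of x y 0] assms tau by simp

lemma S_self [simp]: "S x x = 0"
  using S_eq_0[OF self] r0 by simp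

definition proj :: "'a \<Rightarrow> 'a \<Rightarrow> 'a" where
  "proj z v = \<phi> (S z v) v"

lemma proj_mem: "dist z v \<le> r0 \<Longrightarrow> proj z v \<in> H z"
  by (simp add: proj_def S_mem)

lemma proj_self [simp]: "proj z z = z"
  by (simp add: proj_def)

lemma proj_fix: "v \<in> H z \<Longrightarrow> dist z v \<le> r0 \<Longrightarrow> proj z v = v"
  by (simp add: proj_def S_eq_0)

lemma proj_continuous_on [continuous_intros]:
  assumes "continuous_on A f" "continuous_on A g"
  shows "continuous_on A (\<lambda>i. proj (f i) (g i))"
  unfolding proj_def using assms by (intro continuous_intros)

lemma proj_uniform:
  assumes "0 < e"
  obtains \<delta> where "0 < \<delta>"
    "\<And>x y v w. \<lbrakk>dist x y \<le> \<delta>; dist v w \<le> \<delta>\<rbrakk> \<Longrightarrow> dist (proj x v) (proj y w) \<le> e"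
proof -
  obtain d1 where d1: "0 < d1"
    "\<And>s s' v w. \<lbrakk>\<bar>s\<bar> \<le> 2; \<bar>s'\<bar> \<le> 2; \<bar>s - s'\<bar> \<le> d1; dist v w \<le> d1\<rbrakk> \<Longrightarrow> dist (\<phi> s v) (\<phi> s' w) \<le> e"
    using phi_uniform[OF assms] by blast
  obtain d2 where d2: "0 < d2"
    "\<And>x y v w. \<lbrakk>dist x y \<le> d2; dist v w \<le> d2\<rbrakk> \<Longrightarrow> \<bar>S x v - S y w\<bar> \<le> d1"
    using S_uniform[OF d1(1)] by blast
  have b: "\<bar>S x v\<bar> \<le> 2" for x v using S_bound[of x v] tau by linarith
  show ?thesis
    by (rule that[of "min d1 d2"]) (auto simp: proj_def d1 d2 b)
qed

text \<open>The base \<open>u\<close> is a bi-infinite sequence of points at which sections are erected;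
  \<open>hol d u n y\<close> is the time at which the orbit of \<open>y\<close>, followed in direction \<open>d = \<plusminus>1\<close>, meets the
  section at \<open>u (d * n)\<close>, and \<open>pt d u n y\<close> is the point where it does so.\<close>

primrec hol :: "int \<Rightarrow> (int \<Rightarrow> 'a) \<Rightarrow> nat \<Rightarrow> 'a \<Rightarrow> real" where
  "hol d u 0 y = 0"
| "hol d u (Suc n) y = hol d u n y + of_int d
     + S (u (d * int (Suc n))) (\<phi> (hol d u n y + of_int d) y)"

definition pt :: "int \<Rightarrow> (int \<Rightarrow> 'a) \<Rightarrow> nat \<Rightarrow> 'a \<Rightarrow> 'a" where
  "pt d u n y = \<phi> (hol d u n y) y"

lemma pt_0 [simp]: "pt d u 0 y = y"
  by (simp add: pt_def)

lemma pt_Suc: "pt d u (Suc n) y = proj (u (d * int (Suc n))) (\<phi> (of_int d) (pt d u n y))"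
  by (simp add: pt_def proj_def add_ac)

lemma hol_Suc: "hol d u (Suc n) y = hol d u n y + of_int d
     + S (u (d * int (Suc n))) (\<phi> (of_int d) (pt d u n y))"
  by (simp add: pt_def add_ac)

declare hol.simps(2) [simp del]

lemma hol_add: "hol d u (n + k) y = hol d u n y + hol d (\<lambda>j. u (j + d * int n)) k (pt d u n y)"
proof (induction k)
  case (Suc k)
  have "pt d u (n + k) y = pt d (\<lambda>j. u (j + d * int n)) k (pt d u n y)"
    using Suc by (simp add: pt_def add_ac)
  moreover have "d * int (Suc k) + d * int n = d * int (Suc (n + k))" by (simp add: algebra_simps)
  ultimately show ?case using Suc by (simp add: hol_Suc)
qed simp

lemma pt_add: "pt d u (n + k) y = pt d (\<lambda>j. u (j + d * int n)) k (pt d u n y)"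
  unfolding pt_def hol_add by (simp add: add.commute)

lemma hol_cong:
  assumes "\<And>k. 0 < k \<Longrightarrow> k \<le> n \<Longrightarrow> u (d * int k) = u' (d * int k)"
  shows "hol d u n y = hol d u' n y"
  using assms
proof (induction n)
  case (Suc n)
  then have "hol d u n y = hol d u' n y" by simp
  then show ?case using Suc(2)[of "Suc n"] by (simp add: hol_Suc pt_def)
qed simp

lemma pt_cong:
  assumes "\<And>k. 0 < k \<Longrightarrow> k \<le> n \<Longrightarrow> u (d * int k) = u' (d * int k)"
  shows "pt d u n y = pt d u' n y"
proof -
  have "hol d u n y = hol d u' n y" by (rule hol_cong) (rule assms)
  then show ?thesis by (simp add: pt_def)
qed

lemma hol_tendsto:
  assumes "\<And>j. ((\<lambda>i. u i j) \<longlongrightarrow> u' j) F" "(y \<longlongrightarrow> y') F"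
  shows "((\<lambda>i. hol d (u i) n (y i)) \<longlongrightarrow> hol d u' n y') F"
  by (induction n)
    (auto simp: hol.simps(2) intro!: assms tendsto_intros S_tendsto phi_tendsto simp del: phi_add)

lemma pt_tendsto:
  assumes "\<And>j. ((\<lambda>i. u i j) \<longlongrightarrow> u' j) F" "(y \<longlongrightarrow> y') F"
  shows "((\<lambda>i. pt d (u i) n (y i)) \<longlongrightarrow> pt d u' n y') F"
  unfolding pt_def by (intro phi_tendsto hol_tendsto assms)

lemma hol_continuous_on [continuous_intros]: "continuous_on A (hol d u n)"
  unfolding continuous_on_def by (auto intro!: hol_tendsto)

lemma pt_continuous_on [continuous_intros]: "continuous_on A (pt d u n)"
  unfolding continuous_on_def by (auto intro!: pt_tendsto)

text \<open>One step is uniformly continuous jointly in the base point and the moving point, so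
  \<open>\<delta>\<close> depends on the number of steps but not on the base
  \<open>u\<close>.\<close>

lemma pt_equicontinuous:
  assumes "0 < e" "d \<in> {1, -1}"
  shows "\<exists>\<delta>>0. \<forall>n\<le>N. \<forall>u v w. dist v w \<le> \<delta> \<longrightarrow> dist (pt d u n v) (pt d u n w) \<le> e"
  using assms(1)
proof (induction N arbitrary: e)
  case 0
  then show ?case by auto
next
  case (Suc N)
  obtain d1 where d1: "0 < d1"
    "\<And>x y v w. \<lbrakk>dist x y \<le> d1; dist v w \<le> d1\<rbrakk> \<Longrightarrow> dist (proj x v) (proj y w) \<le> e"
    using proj_uniform[OF Suc(2)] by blast
  obtain d2 where d2: "0 < d2"
    "\<And>s s' v w. \<lbrakk>\<bar>s\<bar> \<le> 2; \<bar>s'\<bar> \<le> 2; \<bar>s - s'\<bar> \<le> d2; dist v w \<le> d2\<rbrakk> \<Longrightarrow> dist (\<phi> s v) (\<phi> s' w) \<le> d1"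
    using phi_uniform[OF d1(1)] by blast
  obtain d3 where d3: "0 < d3"
    "\<And>n u v w. n \<le> N \<Longrightarrow> dist v w \<le> d3 \<Longrightarrow> dist (pt d u n v) (pt d u n w) \<le> min e d2"
    using Suc.IH[of "min e d2"] Suc.prems d2 by auto
  have "dist (pt d u n v) (pt d u n w) \<le> e" if "n \<le> Suc N" "dist v w \<le> d3" for n u v w
  proof (cases "n \<le> N")
    case True
    then show ?thesis using d3(2)[of n v w u] that by simp
  next
    case False
    then have n: "n = Suc N" using that by simp
    show ?thesis unfolding n pt_Suc
      using d1 d2 d3(2)[of N v w u] that assms(2) by (auto intro!: d1 d2)
  qed
  then show ?case using d3 by blast
qed

text \<open>Both time directions get the same bound, so that \<open>d = 1\<close> and
  \<open>d = -1\<close> can be treated alike.\<close>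

definition pseudo :: "real \<Rightarrow> (int \<Rightarrow> 'a) \<Rightarrow> bool" where
  "pseudo k u \<longleftrightarrow> (\<forall>j. dist (\<phi> 1 (u j)) (u (j + 1)) \<le> k \<and> dist (\<phi> (-1) (u (j + 1))) (u j) \<le> k)"

lemma pseudoD: "pseudo k u \<Longrightarrow> d \<in> {1, -1} \<Longrightarrow> dist (\<phi> (of_int d) (u j)) (u (j + d)) \<le> k"
  unfolding pseudo_def by (auto dest: spec[of _ j] spec[of _ "j - 1"])

lemma pseudo_shift: "pseudo k u \<Longrightarrow> pseudo k (\<lambda>j. u (j + i))"
  unfolding pseudo_def by (metis add.assoc add.commute)

lemma pseudo_mono: "pseudo k u \<Longrightarrow> k \<le> k' \<Longrightarrow> pseudo k' u"
  unfolding pseudo_def by (meson order_trans)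

lemma pseudo_orbit:
  assumes "\<And>j. u (j + 1) = \<phi> 1 (u j)" "0 \<le> k"
  shows "pseudo k u"
  unfolding pseudo_def using assms by simp

text \<open>Half of \<open>r0\<close> is spent on the jump of the pseudo-orbit and half on the
  spreading of the two points in one step. The total is the range in which \<open>S\<close> finds
  the section.\<close>

lemma step_close:
  assumes "pseudo (r0/2) u" "d \<in> {1, -1}" "dist (u j) v \<le> \<rho>"
  shows "dist (u (j + d)) (\<phi> (of_int d) v) \<le> r0"
proof -
  have "of_int d \<in> {1, -1 :: real}" using assms(2) by auto
  then have "dist (\<phi> (of_int d) (u j)) (\<phi> (of_int d) v) \<le> r0/2"
    using rho_step[OF assms(3)] by blast
  then show ?thesis using pseudoD[OF assms(1,2), of j]
    by (metis (no_types, opaque_lifting) add.commute dist_commute dist_triangle_le add_mono field_sum_of_halves)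
qed

lemma pt_mem:
  assumes "pseudo (r0/2) u" "d \<in> {1, -1}" "y \<in> H (u 0)"
    "\<And>k. k < n \<Longrightarrow> dist (u (d * int k)) (pt d u k y) \<le> \<rho>"
  shows "pt d u n y \<in> H (u (d * int n))"
proof (cases n)
  case (Suc m)
  have "d * int m + d = d * int (Suc m)" by (simp add: algebra_simps)
  moreover have "dist (u (d * int m + d)) (\<phi> (of_int d) (pt d u m y)) \<le> r0"
    using assms Suc by (intro step_close) auto
  ultimately show ?thesis unfolding Suc pt_Suc using proj_mem by metis
qed (use assms in simp)

text \<open>If a forward step used the section time \<open>s\<close>, then going back one step and
  correcting by \<open>- s\<close> returns to the previous section. By \<open>S_unique\<close> this
  is the correction that the backward holonomy chooses, so it retraces the hit times.\<close>

lemma hol_reverse: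
  assumes u: "pseudo (r0/2) u" and d: "d \<in> {1, -1}" and y: "y \<in> H (u 0)"
    and close: "\<And>k. k \<le> n \<Longrightarrow> dist (u (d * int k)) (pt d u k y) \<le> \<rho>"
    and k: "k \<le> n"
  shows "hol (-d) (\<lambda>j. u (j + d * int n)) k (pt d u n y) = hol d u (n - k) y - hol d u n y"
  using k
proof (induction k)
  case (Suc k)
  define m where "m = n - Suc k"
  have nk: "n - k = Suc m" "n = Suc m + k" using Suc m_def by auto
  have IH: "hol (-d) (\<lambda>j. u (j + d * int n)) k (pt d u n y) = hol d u (Suc m) y - hol d u n y"
    using Suc nk by simp
  have pt: "pt (-d) (\<lambda>j. u (j + d * int n)) k (pt d u n y) = pt d u (Suc m) y"
    unfolding pt_def[of "-d"] IH by (simp add: pt_def)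
  have ix: "- d * int (Suc k) + d * int n = d * int m" using nk by (simp add: algebra_simps)
  define s where "s = S (u (d * int (Suc m))) (\<phi> (of_int d) (pt d u m y))"
  have ptS: "pt d u (Suc m) y = \<phi> (s + of_int d) (pt d u m y)"
    by (simp add: pt_Suc proj_def s_def)
  have "S (u (d * int m)) (\<phi> s (pt d u m y)) = - s"
  proof (rule S_unique)
    have d': "-d \<in> {1,-1}" using d by auto
    have "dist (u (d * int (Suc m))) (pt d u (Suc m) y) \<le> \<rho>" using close[of "Suc m"] nk by simp
    from step_close[OF u d' this]
    have "dist (u (d * int (Suc m) + - d)) (\<phi> (- of_int d) (\<phi> (s + of_int d) (pt d u m y))) \<le> r0"
      by (simp add: ptS)
    then show "dist (u (d * int m)) (\<phi> s (pt d u m y)) \<le> r0" by (simp add: algebra_simps)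
    have "pt d u m y \<in> H (u (d * int m))"
      using u d y close nk by (intro pt_mem) auto
    then show "\<phi> (- s) (\<phi> s (pt d u m y)) \<in> H (u (d * int m))" by simp
    show "\<bar>- s\<bar> \<le> 3 * \<tau> / 4" using S_bound[of "u (d * int (Suc m))" "\<phi> (of_int d) (pt d u m y)"] tau
      by (simp add: s_def)
  qed
  moreover have "\<phi> (of_int (- d)) (pt (-d) (\<lambda>j. u (j + d * int n)) k (pt d u n y)) = \<phi> s (pt d u m y)"
    unfolding pt ptS by simp
  ultimately have "hol (-d) (\<lambda>j. u (j + d * int n)) (Suc k) (pt d u n y)
      = hol d u (Suc m) y - hol d u n y - of_int d - s"
    unfolding hol_Suc ix IH by simp
  also have "\<dots> = hol d u m y - hol d u n y" by (simp add: hol_Suc s_def)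
  finally show ?case by (simp add: m_def)
qed simp

lemma pt_reverse:
  assumes "pseudo (r0/2) u" "d \<in> {1, -1}" "y \<in> H (u 0)"
    "\<And>k. k \<le> n \<Longrightarrow> dist (u (d * int k)) (pt d u k y) \<le> \<rho>" "k \<le> n"
  shows "pt (-d) (\<lambda>j. u (j + d * int n)) k (pt d u n y) = pt d u (n - k) y"
proof -
  have "hol (-d) (\<lambda>j. u (j + d * int n)) k (pt d u n y) = hol d u (n - k) y - hol d u n y"
    by (rule hol_reverse) (use assms in auto)
  then show ?thesis unfolding pt_def[of "-d"] by (simp add: pt_def)
qed

end

subsection \<open>Continua that shadow a pseudo-orbit\<close>

text \<open>Piecewise linear interpolation; it turns discrete hit times into a continuous change of
  time.\<close>

definition interp :: "(int \<Rightarrow> real) \<Rightarrow> real \<Rightarrow> real" where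
  "interp c t = c \<lfloor>t\<rfloor> + (t - of_int \<lfloor>t\<rfloor>) * (c (\<lfloor>t\<rfloor> + 1) - c \<lfloor>t\<rfloor>)"

lemma interp_eq:
  assumes "of_int j \<le> t" "t \<le> of_int j + 1"
  shows "interp c t = c j + (t - of_int j) * (c (j + 1) - c j)"
proof (cases "t = of_int j + 1")
  case True
  then have "\<lfloor>t\<rfloor> = j + 1" by (simp add: floor_eq_iff)
  then show ?thesis using True by (simp add: interp_def)
next
  case False
  then have "\<lfloor>t\<rfloor> = j" using assms by (simp add: floor_eq_iff)
  then show ?thesis by (simp add: interp_def)
qed

lemma mono_if_mono_on_unit_intervals:
  fixes f :: "real \<Rightarrow> real"
  assumes step: "\<And>j s t. \<lbrakk>of_int j \<le> s; s \<le> t; t \<le> of_int j + 1\<rbrakk> \<Longrightarrow> f s \<le> f t"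
    and "s \<le> t"
  shows "f s \<le> f t"
proof (cases "\<lfloor>s\<rfloor> = \<lfloor>t\<rfloor>")
  case True
  then show ?thesis using step[of "\<lfloor>s\<rfloor>" s t] assms(2) by linarith
next
  case False
  then have le: "\<lfloor>s\<rfloor> + 1 \<le> \<lfloor>t\<rfloor>" using floor_mono[OF assms(2)] by linarith
  have ind: "f (of_int i) \<le> f (of_int (i + int n))" for i n
  proof (induction n)
    case (Suc n)
    have "f (of_int (i + int n)) \<le> f (of_int (i + int (Suc n)))"
      by (rule step[of "i + int n"]) auto
    then show ?case using Suc by linarith
  qed simp
  have "f s \<le> f (of_int (\<lfloor>s\<rfloor> + 1))" by (rule step[of "\<lfloor>s\<rfloor>"]) (use floor_correct[of s] in auto)
  also have "\<dots> \<le> f (of_int \<lfloor>t\<rfloor>)"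
    using ind[of "\<lfloor>s\<rfloor> + 1" "nat (\<lfloor>t\<rfloor> - (\<lfloor>s\<rfloor> + 1))"] le by simp
  also have "\<dots> \<le> f t" by (rule step[of "\<lfloor>t\<rfloor>"]) (use floor_correct[of t] in auto)
  finally show ?thesis .
qed

lemma interp_slope:
  assumes c: "\<And>j. l \<le> c (j + 1) - c j" "\<And>j. c (j + 1) - c j \<le> L" and "s \<le> t"
  shows "l * (t - s) \<le> interp c t - interp c s" "interp c t - interp c s \<le> L * (t - s)"
proof -
  have *: "interp c t - interp c s = (t - s) * (c (j + 1) - c j)"
    if "of_int j \<le> s" "s \<le> t" "t \<le> of_int j + 1" for j s t
    using that by (simp add: interp_eq[of j] algebra_simps)
  \<comment> \<open>On unit intervals \<open>interp c\<close> is affine. Subtracting the line of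
    slope \<open>l\<close> turns the slope bound into monotonicity, which passes from unit intervals
    to the whole line.\<close>
  have "interp c s - l * s \<le> interp c t - l * t"
  proof (rule mono_if_mono_on_unit_intervals[where f = "\<lambda>t. interp c t - l * t", OF _ \<open>s \<le> t\<close>])
    fix j s t assume "of_int j \<le> s" "s \<le> t" "t \<le> of_int j + (1::real)"
    then show "interp c s - l * s \<le> interp c t - l * t"
      using *[of j s t] mult_left_mono[OF c(1)[of j], of "t - s"] by (simp add: algebra_simps)
  qed
  then show "l * (t - s) \<le> interp c t - interp c s" by (simp add: algebra_simps)
  have "L * s - interp c s \<le> L * t - interp c t"
  proof (rule mono_if_mono_on_unit_intervals[where f = "\<lambda>t. L * t - interp c t", OF _ \<open>s \<le> t\<close>])
    fix j s t assume "of_int j \<le> s" "s \<le> t" "t \<le> of_int j + (1::real)"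
    then show "L * s - interp c s \<le> L * t - interp c t"
      using *[of j s t] mult_left_mono[OF c(2)[of j], of "t - s"] by (simp add: algebra_simps)
  qed
  then show "interp c t - interp c s \<le> L * (t - s)" by (simp add: algebra_simps)
qed

lemma continuous_on_if_slope_le:
  fixes f :: "real \<Rightarrow> real"
  assumes "\<And>s t. s \<le> t \<Longrightarrow> \<bar>f t - f s\<bar> \<le> L * (t - s)" "0 \<le> L"
  shows "continuous_on UNIV f"
proof (rule lipschitz_on_continuous_on)
  show "L-lipschitz_on UNIV f"
  proof (rule lipschitz_onI)
    show "dist (f s) (f t) \<le> L * dist s t" for s t
      using assms(1)[of s t] assms(1)[of t s]
      by (cases "s \<le> t") (auto simp: dist_real_def abs_minus_commute)
  qed fact
qed

lemma interp_continuous_on: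
  assumes c: "\<And>j. 0 \<le> c (j + 1) - c j" "\<And>j. c (j + 1) - c j \<le> L"
  shows "continuous_on UNIV (interp c)"
proof (rule continuous_on_if_slope_le)
  show "0 \<le> L" using order_trans[OF c(1)[of 0] c(2)[of 0]] .
  show "\<bar>interp c t - interp c s\<bar> \<le> L * (t - s)" if "s \<le> t" for s t
    using interp_slope[of 0 c L s t] c that by simp
qed

text \<open>The lower slope bound gives surjectivity and makes the inverse Lipschitz with constant
  \<open>2\<close>. The inverse serves to normalise one orbit to its own time, as
  \<open>time_changes\<close> demands of the base point.\<close>

lemma interp_inverse:
  assumes c: "\<And>j. 1/2 \<le> c (j + 1) - c j" "\<And>j. c (j + 1) - c j \<le> L" and c0: "c 0 = 0"
  obtains g where "continuous_on UNIV g" "\<And>t. interp c (g t) = t" "g 0 = 0"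
proof -
  have i0: "interp c 0 = 0" using c0 by (simp add: interp_def)
  have cont: "continuous_on UNIV (interp c)"
  proof (rule interp_continuous_on)
    show "0 \<le> c (j + 1) - c j" "c (j + 1) - c j \<le> L" for j using c[of j] by linarith+
  qed
  have slope: "(t - s)/2 \<le> interp c t - interp c s" if "s \<le> t" for s t
    using interp_slope(1)[of "1/2" c L s t] c that by simp
  have "\<exists>x. interp c x = y" for y
  proof (cases "0 \<le> y")
    case True
    then have "y \<le> interp c (2*y)" using slope[of 0 "2*y"] i0 by simp
    then show ?thesis
      using IVT'[of "interp c" 0 y "2*y"] True i0 continuous_on_subset[OF cont] by auto
  next
    case False
    then have "interp c (2*y) \<le> y" using slope[of "2*y" 0] i0 by simp
    then show ?thesis
      using IVT'[of "interp c" "2*y" y 0] False i0 continuous_on_subset[OF cont] by auto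
  qed
  then obtain g where g: "\<And>y. interp c (g y) = y" by metis
  have mono: "g s \<le> g t" if "s \<le> t" for s t
    by (rule ccontr) (use slope[of "g t" "g s"] g[of s] g[of t] that in simp)
  have "\<bar>g t - g s\<bar> \<le> 2 * (t - s)" if "s \<le> t" for s t
    using slope[OF mono[OF that]] mono[OF that] g by simp
  then have "continuous_on UNIV g" by (rule continuous_on_if_slope_le) auto
  moreover have "g 0 = 0"
    using slope[of 0 "g 0"] slope[of "g 0" 0] g[of 0] i0 by (cases "0 \<le> g 0") simp_all
  ultimately show ?thesis using that g by blast
qed

section \<open>Bi-infinite hit times and the time changes built from them\<close>

context section_flow begin

definition knots :: "(int \<Rightarrow> 'a) \<Rightarrow> 'a \<Rightarrow> int \<Rightarrow> real" where
  "knots u y j = (if 0 \<le> j then hol 1 u (nat j) y else hol (-1) u (nat (-j)) y)"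

lemma knots_0 [simp]: "knots u y 0 = 0"
  by (simp add: knots_def)

lemma knots_Suc_nonneg:
  assumes "0 \<le> j"
  shows "knots u y (j + 1) - knots u y j = 1 + S (u (j + 1)) (\<phi> 1 (pt 1 u (nat j) y))"
proof -
  have "nat (j + 1) = Suc (nat j)" using assms by simp
  then show ?thesis using assms by (simp add: knots_def hol_Suc add_ac)
qed

text \<open>Here the backward holonomy steps from \<open>j + 1\<close> down to \<open>j\<close>, so
  the section time belongs to \<open>u j\<close> and enters with the opposite sign.\<close>

lemma knots_Suc_neg:
  assumes "j < 0"
  shows "knots u y (j + 1) - knots u y j = 1 - S (u j) (\<phi> (-1) (pt (-1) u (nat (- (j + 1))) y))"
proof -
  have "nat (- j) = Suc (nat (- (j + 1)))" using assms by simp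
  then have "knots u y j = hol (-1) u (nat (- (j + 1))) y - 1
      + S (u j) (\<phi> (-1) (pt (-1) u (nat (- (j + 1))) y))"
    using assms by (simp add: knots_def hol_Suc)
  moreover have "knots u y (j + 1) = hol (-1) u (nat (- (j + 1))) y"
    using assms by (cases "j = -1") (auto simp: knots_def)
  ultimately show ?thesis by simp
qed

lemma knots_step: "7/8 \<le> knots u y (j + 1) - knots u y j" "knots u y (j + 1) - knots u y j \<le> 9/8"
proof -
  have *: "\<bar>S v w\<bar> \<le> 1/8" for v w using S_bound[of v w] tau by linarith
  show "7/8 \<le> knots u y (j + 1) - knots u y j" "knots u y (j + 1) - knots u y j \<le> 9/8"
    using knots_Suc_nonneg[of j u y] knots_Suc_neg[of j u y]
      *[of "u (j + 1)" "\<phi> 1 (pt 1 u (nat j) y)"] *[of "u j" "\<phi> (-1) (pt (-1) u (nat (- (j + 1))) y)"]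
    by (cases "0 \<le> j"; simp add: abs_le_iff)+
qed

lemma phi_knots:
  "\<phi> (knots u y j) y = (if 0 \<le> j then pt 1 u (nat j) y else pt (-1) u (nat (- j)) y)"
  by (simp add: knots_def pt_def)

text \<open>Orbits that are close at all hit times have nearly equal gaps between hits, because the
  gaps are \<open>1\<close> plus or minus a uniformly continuous section time. Linear interpolation
  then compares nearly equal short times from nearby points.\<close>

lemma phi_interp_knots_close:
  assumes "0 < e"
  obtains \<delta> where "0 < \<delta>"
    "\<And>u y z t. (\<And>j. dist (\<phi> (knots u y j) y) (\<phi> (knots u z j) z) \<le> \<delta>) \<Longrightarrow>
       dist (\<phi> (interp (knots u y) t) y) (\<phi> (interp (knots u z) t) z) \<le> e"
proof -
  obtain d1 where d1: "0 < d1"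
    "\<And>s s' v w. \<lbrakk>\<bar>s\<bar> \<le> 2; \<bar>s'\<bar> \<le> 2; \<bar>s - s'\<bar> \<le> d1; dist v w \<le> d1\<rbrakk> \<Longrightarrow> dist (\<phi> s v) (\<phi> s' w) \<le> e"
    using phi_uniform[OF assms] by blast
  obtain d2 where d2: "0 < d2"
    "\<And>x y v w. \<lbrakk>dist x y \<le> d2; dist v w \<le> d2\<rbrakk> \<Longrightarrow> \<bar>S x v - S y w\<bar> \<le> d1"
    using S_uniform[OF d1(1)] by blast
  obtain d3 where d3: "0 < d3"
    "\<And>s s' v w. \<lbrakk>\<bar>s\<bar> \<le> 2; \<bar>s'\<bar> \<le> 2; \<bar>s - s'\<bar> \<le> d3; dist v w \<le> d3\<rbrakk> \<Longrightarrow> dist (\<phi> s v) (\<phi> s' w) \<le> d2"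
    using phi_uniform[OF d2(1)] by blast
  show ?thesis
  proof (rule that[of "min d1 d3"])
    show "0 < min d1 d3" using d1 d3 by simp
    fix u y z and t :: real
    assume close: "\<And>j. dist (\<phi> (knots u y j) y) (\<phi> (knots u z j) z) \<le> min d1 d3"
    define j where "j = \<lfloor>t\<rfloor>"
    define iy where "iy = knots u y (j + 1) - knots u y j"
    define iz where "iz = knots u z (j + 1) - knots u z j"
    have ij: "\<bar>iy - iz\<bar> \<le> d1"
    proof (cases "0 \<le> j")
      case True
      have "dist (\<phi> 1 (pt 1 u (nat j) y)) (\<phi> 1 (pt 1 u (nat j) z)) \<le> d2"
        using close[of j] True d3(1) by (intro d3(2)) (auto simp: phi_knots)
      then have "\<bar>S (u (j + 1)) (\<phi> 1 (pt 1 u (nat j) y)) - S (u (j + 1)) (\<phi> 1 (pt 1 u (nat j) z))\<bar> \<le> d1"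
        using d2 by simp
      then show ?thesis using True by (simp add: iy_def iz_def knots_Suc_nonneg)
    next
      case False
      let ?n = "nat (- (j + 1))"
      have "dist (pt (-1) u ?n y) (pt (-1) u ?n z) \<le> d3"
        using close[of "j + 1"] False by (cases "j = -1") (auto simp: phi_knots)
      then have "dist (\<phi> (-1) (pt (-1) u ?n y)) (\<phi> (-1) (pt (-1) u ?n z)) \<le> d2"
        using d3(1) by (intro d3(2)) auto
      then have "\<bar>S (u j) (\<phi> (-1) (pt (-1) u ?n y)) - S (u j) (\<phi> (-1) (pt (-1) u ?n z))\<bar> \<le> d1"
        using d2 by simp
      then show ?thesis using False knots_Suc_neg[of j u y] knots_Suc_neg[of j u z]
        by (simp add: iy_def iz_def)
    qed
    define \<theta> where "\<theta> = t - of_int j"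
    have th: "0 \<le> \<theta>" "\<theta> \<le> 1" unfolding \<theta>_def j_def by linarith+
    have bd: "\<bar>\<theta> * iy\<bar> \<le> 2" "\<bar>\<theta> * iz\<bar> \<le> 2"
      using mult_mono[of \<theta> 1 iy "9/8"] mult_mono[of \<theta> 1 iz "9/8"] th
        knots_step[of u y j] knots_step[of u z j] by (auto simp: iy_def[symmetric] iz_def[symmetric])
    have df: "\<bar>\<theta> * iy - \<theta> * iz\<bar> \<le> d1"
    proof -
      have "\<bar>\<theta> * iy - \<theta> * iz\<bar> = \<theta> * \<bar>iy - iz\<bar>"
        using th by (metis abs_mult abs_of_nonneg right_diff_distrib)
      also have "\<dots> \<le> 1 * \<bar>iy - iz\<bar>" using th by (intro mult_right_mono) auto
      finally show ?thesis using ij by simp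
    qed
    have "dist (\<phi> (\<theta> * iy) (\<phi> (knots u y j) y)) (\<phi> (\<theta> * iz) (\<phi> (knots u z j) z)) \<le> e"
      using bd df close[of j] by (intro d1(2)) auto
    moreover have "interp (knots u y) t = \<theta> * iy + knots u y j"
      "interp (knots u z) t = \<theta> * iz + knots u z j"
      by (simp_all add: interp_def \<theta>_def iy_def iz_def j_def)
    ultimately show "dist (\<phi> (interp (knots u y) t) y) (\<phi> (interp (knots u z) t) z) \<le> e" by simp
  qed
qed

text \<open>In interpolated time the points of \<open>A\<close> stay within \<open>e\<close> of each
  other, since both of any two points are within \<open>d/2\<close> of \<open>u j\<close> at each
  hit. Cw-expansiveness with \<open>\<eta> = \<tau>\<close> puts \<open>A\<close> on an orbit
  segment of \<open>x\<close> shorter than the range of \<open>unique\<close>; as \<open>A\<close>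
  also lies in one section, it is a point.\<close>

lemma shadowing_continuum_trivial:
  assumes "cw_expansive \<phi>"
  obtains \<rho>1 where "0 < \<rho>1" "\<rho>1 \<le> \<rho>"
    "\<And>u A x y. \<lbrakk>continuum A; A \<subseteq> H (u 0);
       \<And>z d n. \<lbrakk>z \<in> A; d \<in> {1, -1}\<rbrakk> \<Longrightarrow> dist (u (d * int n)) (pt d u n z) \<le> \<rho>1; x \<in> A; y \<in> A\<rbrakk>
       \<Longrightarrow> x = y"
proof -
  obtain e where e: "0 < e" "\<And>A \<alpha> x. \<lbrakk>\<alpha> \<in> time_changes A; x \<in> A; continuum A; \<alpha> x = id;
      \<forall>t. diameter (moved_set \<phi> \<alpha> t A) \<le> e\<rbrakk> \<Longrightarrow> A \<subseteq> (\<lambda>t. \<phi> t x) ` {-\<tau><..<\<tau>}"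
    using assms tau(1) unfolding cw_expansive_def by meson
  obtain d where d: "0 < d"
    "\<And>u y z t. (\<And>j. dist (\<phi> (knots u y j) y) (\<phi> (knots u z j) z) \<le> d) \<Longrightarrow>
       dist (\<phi> (interp (knots u y) t) y) (\<phi> (interp (knots u z) t) z) \<le> e"
    using phi_interp_knots_close[OF e(1)] by blast
  show ?thesis
  proof (rule that[of "min \<rho> (d/2)"])
    show "0 < min \<rho> (d/2)" using rho d by simp
    show "min \<rho> (d/2) \<le> \<rho>" by simp
    fix u A x y
    assume A: "continuum A" "A \<subseteq> H (u 0)" and xy: "x \<in> A" "y \<in> A"
      and close: "\<And>z d' n. \<lbrakk>z \<in> A; d' \<in> {1, -1}\<rbrakk> \<Longrightarrow> dist (u (d' * int n)) (pt d' u n z) \<le> min \<rho> (d/2)"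
    have cl: "dist (u j) (\<phi> (knots u z j) z) \<le> d/2" if "z \<in> A" for z j
      using close[OF that, of 1 "nat j"] close[OF that, of "-1" "nat (- j)"]
      by (auto simp: phi_knots)
    \<comment> \<open>Composing with the inverse for \<open>x\<close> gives \<open>x\<close> the
      identity as its time change.\<close>
    obtain g where g: "continuous_on UNIV g" "\<And>t. interp (knots u x) (g t) = t" "g 0 = 0"
    proof (rule interp_inverse[of "knots u x" "9/8"])
      show "1/2 \<le> knots u x (j + 1) - knots u x j" "knots u x (j + 1) - knots u x j \<le> 9/8" for j
        using knots_step[of u x j] by linarith+
    qed auto
    define \<alpha> where "\<alpha> z t = interp (knots u z) (g t)" for z t
    have "\<alpha> \<in> time_changes A"
      unfolding time_changes_def
    proof (intro CollectI conjI ballI allI bexI[OF _ xy(1)])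
      fix z
      have "continuous_on UNIV (interp (knots u z))"
      proof (rule interp_continuous_on[of _ "9/8"])
        show "0 \<le> knots u z (j + 1) - knots u z j" "knots u z (j + 1) - knots u z j \<le> 9/8" for j
          using knots_step[of u z j] by linarith+
      qed
      then show "continuous_on UNIV (\<alpha> z)"
        unfolding \<alpha>_def[abs_def] using g(1) by (intro continuous_on_compose2[OF _ g(1)]) auto
      show "\<alpha> z 0 = 0" by (simp add: \<alpha>_def g interp_def)
    next
      show "\<alpha> x = id" by (rule ext) (simp add: \<alpha>_def g)
    next
      fix t
      have "continuous_on A (\<lambda>z. knots u z j)" for j
        unfolding knots_def by (cases "0 \<le> j") (auto intro: hol_continuous_on)
      then show "continuous_on A (\<lambda>z. \<alpha> z t)"
        unfolding \<alpha>_def interp_def by (intro continuous_intros)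
    qed
    moreover have "\<alpha> x = id" by (rule ext) (simp add: \<alpha>_def g)
    moreover have "diameter (moved_set \<phi> \<alpha> t A) \<le> e" for t
    proof (rule diameter_le_dist)
      show "0 \<le> e" using e by simp
      fix p q assume "p \<in> moved_set \<phi> \<alpha> t A" "q \<in> moved_set \<phi> \<alpha> t A"
      then obtain z w where zw: "z \<in> A" "w \<in> A" "p = \<phi> (\<alpha> z t) z" "q = \<phi> (\<alpha> w t) w"
        by (auto simp: moved_set_def)
      have "dist (\<phi> (knots u z j) z) (\<phi> (knots u w j) w) \<le> d" for j
        using cl[OF zw(1), of j] cl[OF zw(2), of j]
        by (metis (no_types, lifting) add_mono dist_commute dist_triangle_le field_sum_of_halves)
      then show "dist p q \<le> e" unfolding zw \<alpha>_def by (rule d(2))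
    qed
    ultimately have "A \<subseteq> (\<lambda>t. \<phi> t x) ` {-\<tau><..<\<tau>}"
      using e(2) xy A by blast
    then obtain t where t: "y = \<phi> t x" "\<bar>t\<bar> \<le> \<tau>" using xy by (auto simp: abs_le_iff)
    then have "t = 0" using unique[of x "u 0" t] A xy by auto
    then show "x = y" using t by simp
  qed
qed

end

subsection \<open>Contraction and uniform stability in the past\<close>

text \<open>Tychonoff's theorem. Pointwise convergence of bases suffices, because finitely many
  steps of the holonomy read finitely many base points.\<close>

lemma compact_UNIV_int_fun:
  assumes "compact (UNIV :: 'a::metric_space set)"
  shows "compact (UNIV :: (int \<Rightarrow> 'a) set)"
proof -
  have "compact_space (product_topology (\<lambda>i::int. euclidean :: 'a topology) UNIV)"
    using assms unfolding compact_space_product_topology by (simp add: compact_space_def)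
  then have "compact_space (euclidean :: (int \<Rightarrow> 'a) topology)"
    unfolding euclidean_product_topology .
  then show ?thesis by (simp add: compact_space_def)
qed

text \<open>Cw-expansiveness enters in the form of \<open>shadowing_trivial\<close>, with
  \<open>\<rho>1\<close> provided by \<open>shadowing_continuum_trivial\<close>.\<close>

locale expansive_section_flow = section_flow +
  fixes \<rho>1 :: real
  assumes rho1: "0 < \<rho>1" "\<rho>1 \<le> \<rho>"
    and shadowing_trivial: "\<And>u A x y. \<lbrakk>continuum A; A \<subseteq> H (u 0);
       \<And>z d n. \<lbrakk>z \<in> A; d \<in> {1, -1}\<rbrakk> \<Longrightarrow> dist (u (d * int n)) (pt d u n z) \<le> \<rho>1; x \<in> A; y \<in> A\<rbrakk>
       \<Longrightarrow> x = y"
    and loc_conn: "locally connected (UNIV :: 'a set)"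
begin

text \<open>Otherwise there are counterexamples for every window \<open>N\<close>. Their bases
  converge along a subsequence, and the upper limit of the continua is a continuum that stays close
  to the limit base at all times and has two points at distance at least \<open>\<sigma>\<close>,
  against \<open>shadowing_trivial\<close>.\<close>

lemma window_contraction:
  assumes "0 < \<sigma>"
  obtains N where
    "\<And>u A x y. \<lbrakk>continuum A; A \<subseteq> H (u 0);
       \<And>z d n. \<lbrakk>z \<in> A; d \<in> {1, -1}; n \<le> N\<rbrakk> \<Longrightarrow> dist (u (d * int n)) (pt d u n z) \<le> \<rho>1; x \<in> A; y \<in> A\<rbrakk>
       \<Longrightarrow> dist x y \<le> \<sigma>"
proof (rule ccontr)
  assume neg: "\<not> thesis"
  have "\<exists>u A x y. continuum A \<and> A \<subseteq> H (u 0) \<and>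
       (\<forall>z\<in>A. \<forall>d\<in>{1, -1}. \<forall>n\<le>N. dist (u (d * int n)) (pt d u n z) \<le> \<rho>1) \<and> x \<in> A \<and> y \<in> A \<and> \<sigma> < dist x y"
    for N :: nat
  proof (rule ccontr)
    assume c: "\<not> ?thesis"
    have thesis
    proof (rule that[of N])
      fix u A x y assume *: "continuum A" "A \<subseteq> H (u 0)" "x \<in> A" "y \<in> A" and
        cl: "\<And>z d n. \<lbrakk>z \<in> A; d \<in> {1, -1}; n \<le> N\<rbrakk> \<Longrightarrow> dist (u (d * int n)) (pt d u n z) \<le> \<rho>1"
      have "\<forall>z\<in>A. \<forall>d\<in>{1, -1}. \<forall>n\<le>N. dist (u (d * int n)) (pt d u n z) \<le> \<rho>1"
        by (intro ballI allI impI cl)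
      then have "\<not> \<sigma> < dist x y" using c * by blast
      then show "dist x y \<le> \<sigma>" by simp
    qed
    then show False using neg by simp
  qed
  then obtain u A x y where uA: "\<And>N::nat. continuum (A N)" "\<And>N. A N \<subseteq> H (u N 0)"
    and cl: "\<And>N z d n. \<lbrakk>z \<in> A N; d \<in> {1, -1}; n \<le> N\<rbrakk> \<Longrightarrow> dist (u N (d * int n)) (pt d (u N) n z) \<le> \<rho>1"
    and xy: "\<And>N. x N \<in> A N" "\<And>N. y N \<in> A N" "\<And>N. \<sigma> < dist (x N) (y N)"
    by metis
  have "compact (UNIV :: ((int \<Rightarrow> 'a) \<times> 'a \<times> 'a) set)"
    using compact_Times[OF compact_UNIV_int_fun[OF comp] compact_Times[OF comp comp]] by simp
  then have "seq_compact (UNIV :: ((int \<Rightarrow> 'a) \<times> 'a \<times> 'a) set)"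
    using compact_eq_seq_compact_metric by blast
  then obtain l r where lr: "strict_mono (r :: nat \<Rightarrow> nat)" "((\<lambda>n. (u n, x n, y n)) \<circ> r) \<longlonglongrightarrow> l"
    by (rule seq_compactE) auto
  obtain v x' y' where l: "l = (v, x', y')" by (cases l) auto
  have "(\<lambda>n. u (r n)) \<longlonglongrightarrow> v" and limx: "(\<lambda>n. x (r n)) \<longlonglongrightarrow> x'" and limy: "(\<lambda>n. y (r n)) \<longlonglongrightarrow> y'"
    using tendsto_fst[OF lr(2)] tendsto_fst[OF tendsto_snd[OF lr(2)]] tendsto_snd[OF tendsto_snd[OF lr(2)]]
    by (simp_all add: l o_def)
  then have limu: "(\<lambda>n. u (r n) j) \<longlonglongrightarrow> v j" for j
    using continuous_on_tendsto_compose[OF continuous_on_product_coordinates[of j]] by auto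
  define B where "B n = A (r n)" for n
  \<comment> \<open>The continua need not converge; convergence of \<open>x (r n)\<close> is enough
    for the upper limit to be connected.\<close>
  define L where "L = (\<Inter>M. closure (\<Union>n\<in>{M..}. B n))"
  have Lseq: "\<exists>(n :: nat \<Rightarrow> nat) z. (\<forall>k. n k \<ge> k \<and> z k \<in> B (n k)) \<and> z \<longlonglongrightarrow> p" if "p \<in> L" for p
  proof -
    have "\<exists>n z. n \<ge> k \<and> z \<in> B n \<and> dist z p < inverse (real (Suc k))" for k
    proof -
      have "p \<in> closure (\<Union>n\<in>{k..}. B n)" using \<open>p \<in> L\<close> by (auto simp: L_def)
      then obtain z where "z \<in> (\<Union>n\<in>{k..}. B n)" "dist z p < inverse (real (Suc k))"
        unfolding closure_approachable by (meson inverse_positive_iff_positive of_nat_0_less_iff zero_less_Suc)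
      then show ?thesis by auto
    qed
    then obtain n z where nz: "\<And>k. n k \<ge> k \<and> z k \<in> B (n k) \<and> dist (z k) p < inverse (real (Suc k))"
      by metis
    have "z \<longlonglongrightarrow> p"
      by (rule metric_tendsto_imp_tendsto[OF LIMSEQ_inverse_real_of_nat])
        (intro always_eventually allI, use nz in \<open>simp add: less_imp_le\<close>)
    then show ?thesis using nz by blast
  qed
  have "connected L"
    unfolding L_def using uA(1) xy(1) limx
    by (intro limsup_connected[OF comp, where x = "\<lambda>n. x (r n)"]) (auto simp: B_def continuum_def)
  moreover have "compact L"
  proof -
    have "closed L" unfolding L_def by auto
    then show ?thesis using compact_Int_closed[OF comp] by simp
  qed
  moreover have inL: "p \<in> L" if "z \<longlonglongrightarrow> p" "\<And>n. z n \<in> B n" for z p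
    unfolding L_def
  proof
    fix M
    have "z n \<in> closure (\<Union>n\<in>{M..}. B n)" if "n \<ge> M" for n
      using \<open>\<And>n. z n \<in> B n\<close>[of n] that by (intro subsetD[OF closure_subset]) auto
    then have "eventually (\<lambda>n. z n \<in> closure (\<Union>n\<in>{M..}. B n)) sequentially"
      unfolding eventually_sequentially by blast
    then show "p \<in> closure (\<Union>n\<in>{M..}. B n)"
      by (rule Lim_in_closed_set[OF closed_closure _ trivial_limit_sequentially that(1)])
  qed
  have x'L: "x' \<in> L" by (rule inL[OF limx]) (simp add: B_def xy)
  have y'L: "y' \<in> L" by (rule inL[OF limy]) (simp add: B_def xy)
  ultimately have contL: "continuum L" by (auto simp: continuum_def)
  have r_ge: "r n \<ge> n" for n using lr(1) by (rule seq_suble)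
  have nlim: "filterlim n at_top sequentially" if "\<And>k. n k \<ge> k" for n :: "nat \<Rightarrow> nat"
    using that by (auto simp: filterlim_at_top eventually_sequentially intro: order_trans)
  have LH: "L \<subseteq> H (v 0)"
  proof
    fix p assume "p \<in> L"
    then obtain n z where nz: "\<And>k. n k \<ge> k" "\<And>k. z k \<in> B (n k)" "z \<longlonglongrightarrow> p"
      using Lseq by metis
    have lu: "(\<lambda>k. u (r (n k)) 0) \<longlonglongrightarrow> v 0"
      by (rule filterlim_compose[OF limu nlim[OF nz(1)]])
    have "(v 0, p) \<in> {(x, y). y \<in> H x}"
      using graph nz(2) uA(2) unfolding closed_graph_field_def B_def
      by (intro closed_sequentially[OF _ _ tendsto_Pair[OF lu nz(3)]]) auto
    then show "p \<in> H (v 0)" by simp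
  qed
  have close: "dist (v (d * int m)) (pt d v m p) \<le> \<rho>1" if p: "p \<in> L" "d \<in> {1, -1}" for p d m
  proof -
    obtain n z where nz: "\<And>k. n k \<ge> k" "\<And>k. z k \<in> B (n k)" "z \<longlonglongrightarrow> p"
      using Lseq[OF p(1)] by metis
    have lu: "(\<lambda>k. u (r (n k)) j) \<longlonglongrightarrow> v j" for j
      by (rule filterlim_compose[OF limu nlim[OF nz(1)]])
    have lim: "(\<lambda>k. dist (u (r (n k)) (d * int m)) (pt d (u (r (n k))) m (z k)))
      \<longlonglongrightarrow> dist (v (d * int m)) (pt d v m p)"
      by (intro tendsto_dist lu pt_tendsto nz)
    \<comment> \<open>Only windows of length at least \<open>m\<close> control step
      \<open>m\<close>, hence the restriction to \<open>k \<ge> m\<close>.\<close>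
    have "dist (u (r (n k)) (d * int m)) (pt d (u (r (n k))) m (z k)) \<le> \<rho>1" if "k \<ge> m" for k
    proof (rule cl)
      show "z k \<in> A (r (n k))" using nz(2) by (simp add: B_def)
      show "m \<le> r (n k)" using that nz(1)[of k] r_ge[of "n k"] by linarith
    qed (rule p(2))
    then show ?thesis by (intro LIMSEQ_le_const2[OF lim]) auto
  qed
  have "x' = y'" using shadowing_trivial[OF contL LH close x'L y'L] .
  moreover have "\<sigma> \<le> dist x' y'"
    using xy(3) by (intro LIMSEQ_le_const[OF tendsto_dist[OF limx limy]]) (auto intro: less_imp_le)
  ultimately show False using assms by simp
qed

lemma continuum_pt_image:
  "continuum A \<Longrightarrow> continuum (pt d u n ` A)"
  unfolding continuum_def by (auto intro!: compact_continuous_image connected_continuous_image pt_continuous_on)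

text \<open>The window is centred at time \<open>n\<close>: the image continuum is followed
  \<open>N\<close> steps further by \<open>pt_add\<close> and \<open>N\<close> steps back by
  \<open>pt_reverse\<close>. The conditions \<open>N \<le> n\<close> and tracking up to
  \<open>n + N\<close> make both halves available.\<close>

lemma forward_contraction:
  assumes "0 < \<sigma>"
  obtains N where
    "\<And>u A n x y. \<lbrakk>pseudo (r0/2) u; continuum A; A \<subseteq> H (u 0); N \<le> n;
       \<And>z k. \<lbrakk>z \<in> A; k \<le> n + N\<rbrakk> \<Longrightarrow> dist (u (int k)) (pt 1 u k z) \<le> \<rho>1; x \<in> A; y \<in> A\<rbrakk>
       \<Longrightarrow> dist (pt 1 u n x) (pt 1 u n y) \<le> \<sigma>"
proof -
  obtain N where N: "\<And>u A x y. \<lbrakk>continuum A; A \<subseteq> H (u 0);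
       \<And>z d n. \<lbrakk>z \<in> A; d \<in> {1, -1}; n \<le> N\<rbrakk> \<Longrightarrow> dist (u (d * int n)) (pt d u n z) \<le> \<rho>1; x \<in> A; y \<in> A\<rbrakk>
       \<Longrightarrow> dist x y \<le> \<sigma>"
    using window_contraction[OF assms] by blast
  show ?thesis
  proof (rule that[of N])
    fix u A n x y
    assume u: "pseudo (r0/2) u" and A: "continuum A" "A \<subseteq> H (u 0)" and n: "N \<le> n"
      and cl: "\<And>z k. \<lbrakk>z \<in> A; k \<le> n + N\<rbrakk> \<Longrightarrow> dist (u (int k)) (pt 1 u k z) \<le> \<rho>1"
      and xy: "x \<in> A" "y \<in> A"
    have cl': "dist (u (1 * int k)) (pt 1 u k z) \<le> \<rho>" if "z \<in> A" "k \<le> n" for z k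
      using cl[OF that(1), of k] that(2) rho1(2) by simp
    define u' where "u' j = u (j + 1 * int n)" for j
    show "dist (pt 1 u n x) (pt 1 u n y) \<le> \<sigma>"
    proof (rule N[of "pt 1 u n ` A" u'])
      show "continuum (pt 1 u n ` A)" using A by (simp add: continuum_pt_image)
      have "pt 1 u n z \<in> H (u (1 * int n))" if "z \<in> A" for z
        by (rule pt_mem[OF u]) (use A that cl' in auto)
      then show "pt 1 u n ` A \<subseteq> H (u' 0)" by (auto simp: u'_def)
      fix w d k assume "w \<in> pt 1 u n ` A" and d: "d \<in> {1, -1 :: int}" and k: "k \<le> N"
      then obtain z where z: "z \<in> A" "w = pt 1 u n z" by auto
      show "dist (u' (d * int k)) (pt d u' k w) \<le> \<rho>1"
      proof (cases "d = 1")
        case True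
        have "pt 1 u' k w = pt 1 u (n + k) z"
          unfolding pt_add u'_def[abs_def] z ..
        then show ?thesis using cl[OF z(1), of "n + k"] k True by (simp add: u'_def add.commute)
      next
        case False
        have "pt (-1) u' k w = pt 1 u (n - k) z"
          unfolding u'_def[abs_def] z using k n
          by (intro pt_reverse[OF u]) (use A z cl' in auto)
        then show ?thesis using cl[OF z(1), of "n - k"] k n d False
          by (simp add: u'_def of_nat_diff algebra_simps)
      qed
    qed (use xy in auto)
  qed
qed

text \<open>Stability of \<open>u 0\<close> along a base sequence that may sample its forward orbit at irregular
  times. This freedom lets stability pass to nearby points without a change to integer times.\<close>

definition stab :: "(int \<Rightarrow> 'a) \<Rightarrow> bool" where
  "stab u \<longleftrightarrow> pseudo (r0/2) u \<and> (\<forall>j<0. u (j + 1) = \<phi> 1 (u j)) \<and>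
     (\<forall>\<epsilon>>0. \<exists>\<delta>>0. \<forall>w\<in>H (u 0). dist (u 0) w \<le> \<delta> \<longrightarrow> (\<forall>n. dist (u (int n)) (pt 1 u n w) \<le> \<epsilon>))"

text \<open>At negative indices the base is an orbit and all section times vanish. At nonnegative
  indices stability, applied to the point \<open>u 0\<close> itself and to every
  \<open>\<epsilon>\<close>, forces its holonomy to coincide with \<open>u\<close>.\<close>

lemma stab_pt_base:
  assumes "stab u"
  shows "pt 1 (\<lambda>j. u (j - int n)) k (u (- int n)) = u (int k - int n)"
proof -
  have upto: "pt 1 (\<lambda>j. u (j - int n)) k (u (- int n)) = u (int k - int n)" if "k \<le> n" for k
    using that
  proof (induction k)
    case (Suc k)
    have "u (int k - int n + 1) = \<phi> 1 (u (int k - int n))"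
      using assms Suc(2) unfolding stab_def by simp
    moreover have "int k - int n + 1 = int (Suc k) - int n" by simp
    ultimately show ?case using Suc by (simp add: pt_Suc)
  qed simp
  show ?thesis
  proof (cases "k \<le> n")
    case False
    then obtain i where i: "k = n + i" by (metis le_add_diff_inverse linear)
    have "dist (u (int i)) (pt 1 u i (u 0)) \<le> e" if "0 < e" for e
      using assms that self[of "u 0"] unfolding stab_def by (metis dist_self less_imp_le)
    then have "u (int i) = pt 1 u i (u 0)" by (metis dist_le_zero_iff field_le_epsilon add_0)
    then show ?thesis using upto[of n] by (simp add: i pt_add)
  qed (rule upto)
qed

text \<open>The point is a radius independent of \<open>n\<close>. Only the first \<open>N\<close>
  steps have to be controlled by the size of \<open>V\<close>; afterwards contraction keeps the good
  points much closer than \<open>\<epsilon>\<close>, so connectedness of \<open>V\<close> prevents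
  any point from being lost, however long it takes to reach \<open>u 0\<close>.\<close>

lemma stab_backward_uniform:
  assumes u: "stab u" and e: "0 < \<epsilon>" "\<epsilon> \<le> \<rho>1"
  obtains \<delta> N where "0 < \<delta>"
    "\<And>n. N \<le> n \<Longrightarrow> \<exists>V. continuum V \<and> V \<subseteq> H (u (- int n)) \<and>
        (\<forall>w\<in>H (u (- int n)). dist (u (- int n)) w \<le> \<delta> \<longrightarrow> w \<in> V) \<and>
        (\<forall>w\<in>V. \<forall>k. dist (u (int k - int n)) (pt 1 (\<lambda>j. u (j - int n)) k w) \<le> \<epsilon>)"
proof -
  have ps: "pseudo (r0/2) u" using u by (simp add: stab_def)
  obtain \<delta>0 where d0: "0 < \<delta>0"
    "\<And>w n. \<lbrakk>w \<in> H (u 0); dist (u 0) w \<le> \<delta>0\<rbrakk> \<Longrightarrow> dist (u (int n)) (pt 1 u n w) \<le> \<epsilon>/2"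
    using u e(1) unfolding stab_def by (meson half_gt_zero)
  \<comment> \<open>Contraction gives \<open>\<sigma>\<close>, and its neighbourhood is cut out by
    the strict bound \<open>2 * \<sigma>\<close>. This must be within the stability radius
    \<open>\<delta>0\<close> at \<open>u 0\<close> and well below \<open>\<epsilon>\<close>.\<close>
  define \<sigma> where "\<sigma> = min (\<delta>0/2) (\<epsilon>/4)"
  have sig: "0 < \<sigma>" "2 * \<sigma> \<le> \<delta>0" "2 * \<sigma> \<le> \<epsilon>/2" using d0 e by (auto simp: \<sigma>_def)
  obtain N where N: "\<And>u A n x y. \<lbrakk>pseudo (r0/2) u; continuum A; A \<subseteq> H (u 0); N \<le> n;
       \<And>z k. \<lbrakk>z \<in> A; k \<le> n + N\<rbrakk> \<Longrightarrow> dist (u (int k)) (pt 1 u k z) \<le> \<rho>1; x \<in> A; y \<in> A\<rbrakk>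
       \<Longrightarrow> dist (pt 1 u n x) (pt 1 u n y) \<le> \<sigma>"
    using forward_contraction[OF sig(1)] by blast
  obtain d1 where d1: "0 < d1"
    "\<And>n u v w. \<lbrakk>n \<le> N; dist v w \<le> d1\<rbrakk> \<Longrightarrow> dist (pt 1 u n v) (pt 1 u n w) \<le> \<epsilon>/2"
    using pt_equicontinuous[of "\<epsilon>/2" 1 N] e(1) by auto
  obtain d2 where d2: "0 < d2"
    "\<And>x y v w. \<lbrakk>dist x y \<le> d2; dist v w \<le> d2\<rbrakk> \<Longrightarrow> dist (proj x v) (proj y w) \<le> d1"
    using proj_uniform[OF d1(1)] by blast
  \<comment> \<open>\<open>r0\<close> ensures that \<open>C\<close> projects into the section,
    \<open>d2\<close> that the projection is within \<open>d1\<close> of the base point and so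
    tracks it for \<open>N\<close> steps.\<close>
  have "0 < min d2 r0" using d2 r0 by simp
  then obtain \<delta> where del: "0 < \<delta>"
    "\<And>x::'a. \<exists>C. connected C \<and> closed C \<and> cball x \<delta> \<subseteq> C \<and> C \<subseteq> cball x (min d2 r0)"
    by (rule uniformly_locally_connected[OF comp loc_conn]) blast
  show ?thesis
  proof (rule that[of \<delta> N])
    show "0 < \<delta>" by fact
    fix n assume n: "N \<le> n"
    define b where "b = u (- int n)"
    define u' where "u' j = u (j - int n)" for j
    have u'0: "u' 0 = b" by (simp add: u'_def b_def)
    have ps': "pseudo (r0/2) u'"
      using pseudo_shift[OF ps, of "- int n"] by (simp add: u'_def[abs_def])
    have base: "pt 1 u' k b = u' (int k)" for k
      using stab_pt_base[OF u] by (simp add: u'_def[abs_def] b_def)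
    obtain C where C: "connected C" "closed C" "cball b \<delta> \<subseteq> C" "C \<subseteq> cball b (min d2 r0)"
      using del by blast
    define V where "V = proj b ` C"
    have cC: "compact C" using compact_Int_closed[OF comp C(2)] by simp
    have bC: "b \<in> C" using C del by auto
    have contV: "continuum V"
      unfolding continuum_def V_def using bC cC C(1)
      by (auto intro!: compact_continuous_image connected_continuous_image continuous_intros)
    have VH: "V \<subseteq> H b" using C(4) by (auto simp: V_def intro!: proj_mem)
    have Vd: "dist b w \<le> d1" if w: "w \<in> V" for w
    proof -
      obtain c where "c \<in> C" "w = proj b c" using w by (auto simp: V_def)
      then show ?thesis using d2(2)[of b b b c] C(4) d2(1) by auto
    qed
    have Vin: "w \<in> V" if "w \<in> H b" "dist b w \<le> \<delta>" for w
    proof -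
      have "w \<in> C" using that C by auto
      moreover have "proj b w = w" using that C \<open>w \<in> C\<close> by (intro proj_fix) auto
      ultimately show ?thesis unfolding V_def by (metis imageI)
    qed
    define D where "D = {w\<in>V. \<forall>k. dist (u' (int k)) (pt 1 u' k w) \<le> \<epsilon>}"
    have bD: "b \<in> D" using e Vin[OF self] del by (simp add: D_def base)
    have "D = V \<inter> (\<Inter>k. {w. dist (u' (int k)) (pt 1 u' k w) \<le> \<epsilon>})" by (auto simp: D_def)
    moreover have "closed (\<Inter>k. {w. dist (u' (int k)) (pt 1 u' k w) \<le> \<epsilon>})"
      by (intro closed_INT ballI closed_Collect_le continuous_intros)
    ultimately have cD: "compact D"
      using contV by (simp add: continuum_def compact_Int_closed)
    define Q where "Q = \<Inter>{K. K \<subseteq> D \<and> closed K \<and> openin (top_of_set D) K \<and> b \<in> K}"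
    note Q = quasi_component_connected[OF cD bD, folded Q_def]
    \<comment> \<open>The component of \<open>b\<close> in \<open>D\<close> contracts, so a clopen neighbourhood of it in \<open>D\<close> satisfies
      strict estimates up to time \<open>n\<close>, when stability of \<open>u 0\<close> takes over. It is therefore open in
      the connected set \<open>V\<close>.\<close>
    define U where "U = (\<Inter>k\<in>{N..n}. {w. dist (u' (int k)) (pt 1 u' k w) < 2 * \<sigma>})"
    have oU: "open U"
      unfolding U_def by (intro open_INT finite_atLeastAtMost ballI open_Collect_less continuous_intros)
    have "Q \<subseteq> U"
    proof
      fix w assume w: "w \<in> Q"
      have "dist (pt 1 u' k b) (pt 1 u' k w) \<le> \<sigma>" if k: "N \<le> k" for k
      proof (rule N[OF ps' _ _ k])
        show "continuum Q" using Q(1-3) by (auto simp: continuum_def)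
        show "Q \<subseteq> H (u' 0)" using Q(4) VH by (auto simp: u'0 D_def)
        show "dist (u' (int i)) (pt 1 u' i z) \<le> \<rho>1" if "z \<in> Q" for z i
        proof -
          have "z \<in> D" using that Q(4) by blast
          then have "dist (u' (int i)) (pt 1 u' i z) \<le> \<epsilon>" by (simp add: D_def)
          then show ?thesis using e(2) by linarith
        qed
      qed (use w Q(3) in auto)
      then show "w \<in> U" using sig(1) by (force simp: U_def base)
    qed
    then obtain K where K: "K \<subseteq> D" "closed K" "openin (top_of_set D) K" "b \<in> K" "K \<subseteq> U"
      using Q(5)[OF oU] by blast
    \<comment> \<open>\<open>U\<close> says nothing about steps before \<open>N\<close>; these are
      covered by the smallness of \<open>V\<close>.\<close>
    have UD: "w \<in> D" if w: "w \<in> V" "w \<in> U" for w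
    proof -
      have early: "dist (u' (int k)) (pt 1 u' k w) \<le> \<epsilon>" if "k \<le> n" for k
      proof (cases "k \<le> N")
        case True
        then show ?thesis using d1(2)[OF True Vd[OF w(1)], of u'] e by (simp add: base)
      next
        case False
        then have "dist (u' (int k)) (pt 1 u' k w) < 2 * \<sigma>" using w(2) that by (auto simp: U_def)
        then show ?thesis using sig e by linarith
      qed
      have late: "dist (u' (int (n + i))) (pt 1 u' (n + i) w) \<le> \<epsilon>" for i
      proof -
        have "pt 1 u' n w \<in> H (u' (1 * int n))"
        proof (rule pt_mem[OF ps'])
          show "w \<in> H (u' 0)" using w VH u'0 by auto
          show "dist (u' (1 * int k)) (pt 1 u' k w) \<le> \<rho>" if "k < n" for k
            using early[of k] that e rho1 by simp
        qed simp
        then have m: "pt 1 u' n w \<in> H (u 0)" by (simp add: u'_def)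
        have "dist (u' (int n)) (pt 1 u' n w) < 2 * \<sigma>" using w(2) n by (auto simp: U_def)
        then have "dist (u 0) (pt 1 u' n w) \<le> \<delta>0" using sig by (simp add: u'_def)
        then have "dist (u (int i)) (pt 1 u i (pt 1 u' n w)) \<le> \<epsilon>/2" using d0(2)[OF m] by simp
        moreover have "pt 1 u' (n + i) w = pt 1 u i (pt 1 u' n w)"
          unfolding pt_add by (simp add: u'_def[abs_def])
        ultimately show ?thesis using e by (simp add: u'_def)
      qed
      have "dist (u' (int k)) (pt 1 u' k w) \<le> \<epsilon>" for k
        using early[of k] late[of "k - n"] by (cases "k \<le> n") auto
      then show ?thesis using w by (simp add: D_def)
    qed
    obtain T where T: "open T" "K = D \<inter> T" using K(3) by (auto simp: openin_open)
    have "K = V \<inter> (T \<inter> U)" using T K UD by (auto simp: D_def)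
    then have "openin (top_of_set V) K" using T oU by (metis open_Int openin_open_Int)
    moreover have "closedin (top_of_set V) K"
      using K(1,2) by (intro closed_subset) (auto simp: D_def)
    ultimately have "K = V" using contV K(4) unfolding continuum_def connected_clopen by blast
    then have "V \<subseteq> D" using K by simp
    then show "\<exists>V. continuum V \<and> V \<subseteq> H (u (- int n)) \<and>
        (\<forall>w\<in>H (u (- int n)). dist (u (- int n)) w \<le> \<delta> \<longrightarrow> w \<in> V) \<and>
        (\<forall>w\<in>V. \<forall>k. dist (u (int k - int n)) (pt 1 (\<lambda>j. u (j - int n)) k w) \<le> \<epsilon>)"
      using contV VH Vin unfolding D_def u'_def[abs_def] b_def by blast
  qed
qed

end

subsection \<open>Periodic attractors\<close>

context section_flow begin

lemma hol_bounds: "7/8 * real n \<le> hol 1 u n y" "hol 1 u n y \<le> 9/8 * real n"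
proof (induction n)
  case (Suc n)
  have *: "\<bar>S v w\<bar> \<le> 1/8" for v w using S_bound[of v w] tau by linarith
  show "7/8 * real (Suc n) \<le> hol 1 u (Suc n) y" "hol 1 u (Suc n) y \<le> 9/8 * real (Suc n)"
    using Suc *[of "u (1 * int (Suc n))" "\<phi> (of_int 1) (pt 1 u n y)"]
    unfolding hol_Suc abs_le_iff by (simp_all add: algebra_simps)
qed auto

lemma hol_bracket:
  assumes "0 \<le> t"
  obtains k where "hol 1 u k y \<le> t" "t \<le> hol 1 u (Suc k) y"
proof -
  obtain n where "t \<le> 7/8 * real n"
    using real_arch_simple[of "8/7 * t"] by (auto simp: field_simps)
  then have ex: "t \<le> hol 1 u n y" using hol_bounds(1)[of n u y] by linarith
  define k where "k = (LEAST n. t \<le> hol 1 u n y)"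
  have k: "t \<le> hol 1 u k y" unfolding k_def using ex by (rule LeastI)
  show ?thesis
  proof (cases k)
    case 0
    then have "t = 0" using k assms by simp
    then show ?thesis using hol_bounds(1)[of "Suc 0" u y] by (intro that[of 0]) auto
  next
    case (Suc i)
    then have "\<not> t \<le> hol 1 u i y" using not_less_Least[of i "\<lambda>n. t \<le> hol 1 u n y"] k_def by simp
    then show ?thesis using k Suc by (intro that[of i]) auto
  qed
qed

lemma period_multiple:
  assumes "\<phi> T p = p"
  shows "\<phi> (of_int k * T) p = p"
proof (induction k rule: int_induct[of _ 0])
  case (step1 i)
  have "\<phi> (of_int (i + 1) * T) p = \<phi> (of_int i * T) (\<phi> T p)" by (simp add: algebra_simps)
  then show ?case using step1 assms by simp
next
  case (step2 i)
  have "\<phi> (of_int (i - 1) * T) (\<phi> T p) = \<phi> (of_int i * T) p" by (simp add: algebra_simps)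
  then show ?case using step2 assms by simp
qed simp

lemma periodic_orbit_eq:
  assumes "\<phi> T p = p" "0 < T"
  shows "range (\<lambda>t. \<phi> t p) = (\<lambda>t. \<phi> t p) ` {0..T}"
proof (intro equalityI subsetI)
  fix x assume "x \<in> range (\<lambda>t. \<phi> t p)"
  then obtain t where t: "x = \<phi> t p" by auto
  define k where "k = \<lfloor>t / T\<rfloor>"
  have "of_int k \<le> t / T" "t / T \<le> of_int k + 1" unfolding k_def by linarith+
  then have "0 \<le> t - of_int k * T" "t - of_int k * T \<le> T"
    using assms(2) by (simp_all add: field_simps)
  moreover have "\<phi> (t - of_int k * T) (\<phi> (of_int k * T) p) = x" by (simp add: t)
  then have "x = \<phi> (t - of_int k * T) p" by (simp add: period_multiple[OF assms(1)])
  ultimately show "x \<in> (\<lambda>t. \<phi> t p) ` {0..T}" by auto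
qed auto

lemma closed_periodic_orbit:
  assumes "\<phi> T p = p" "0 < T"
  shows "closed (range (\<lambda>t. \<phi> t p))"
  unfolding periodic_orbit_eq[OF assms]
  by (intro compact_imp_closed compact_continuous_image continuous_intros) auto

text \<open>Passing from the base \<open>q\<close> to \<open>v\<close> shifts each hit by one
  section time. Consecutive shifts \<open>t\<close>, \<open>t'\<close> and the section time
  \<open>s\<close> over \<open>q\<close> combine to \<open>s + t' - t\<close>, which is at most
  \<open>3 * \<tau> / 4\<close>, so \<open>S_unique\<close> identifies it as the section time over
  \<open>v\<close>. The lemma carries tracking estimates along \<open>q\<close> over to
  \<open>v\<close>.\<close>

lemma base_change:
  assumes v: "pseudo (r0/2) v" and w: "w \<in> H (v 0)" and w': "w' = proj b w"
    and \<rho>3: "\<And>x y. dist x y \<le> \<rho>3 \<Longrightarrow> dist x (proj x y) \<le> \<rho>" "\<rho>3 \<le> r0"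
    and close: "\<And>n. dist (v (int n)) (pt 1 q n w') \<le> \<rho>3"
  shows "pt 1 v n w = proj (v (int n)) (pt 1 q n w')"
proof -
  have "hol 1 v n w = S b w + hol 1 q n w' + S (v (int n)) (pt 1 q n w')"
  proof (induction n)
    case 0
    have "S (v 0) w' = - S b w"
    proof (rule S_unique)
      show "dist (v 0) w' \<le> r0" using close[of 0] \<rho>3 by simp
      show "\<phi> (- S b w) w' \<in> H (v 0)" using w by (simp add: w' proj_def)
      show "\<bar>- S b w\<bar> \<le> 3 * \<tau> / 4" using S_bound[of b w] tau by simp
    qed
    then show ?case by simp
  next
    case (Suc n)
    define x where "x = pt 1 q n w'"
    define x' where "x' = pt 1 q (Suc n) w'"
    define t where "t = S (v (int n)) x"
    define s where "s = S (q (int (Suc n))) (\<phi> 1 x)"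
    define t' where "t' = S (v (int (Suc n))) x'"
    have x': "x' = \<phi> (s + 1) x" by (simp add: x'_def x_def s_def pt_Suc proj_def)
    have "pt 1 v n w = \<phi> (S b w + hol 1 q n w' + t) w"
      unfolding pt_def[of 1 v] Suc by (simp add: t_def x_def)
    also have "\<dots> = \<phi> t x" by (simp add: x_def pt_def w' proj_def add_ac)
    finally have pv: "pt 1 v n w = \<phi> t x" .
    have "dist (v (int n)) (\<phi> t x) \<le> \<rho>"
      using \<rho>3(1)[OF close[of n]] by (simp add: proj_def t_def x_def)
    from step_close[OF v _ this, of 1]
    have d: "dist (v (int n + 1)) (\<phi> 1 (\<phi> t x)) \<le> r0" by simp
    have "S (v (int n + 1)) (\<phi> 1 (\<phi> t x)) = s + t' - t"
    proof (rule S_unique[OF d])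
      have "\<phi> (s + t' - t) (\<phi> 1 (\<phi> t x)) = proj (v (int (Suc n))) x'"
      proof -
        have "proj (v (int (Suc n))) x' = \<phi> t' x'" by (simp add: proj_def t'_def)
        then show ?thesis unfolding x' by (simp add: add_ac)
      qed
      moreover have "dist (v (int (Suc n))) x' \<le> r0" using close[of "Suc n"] \<rho>3(2) by (simp add: x'_def)
      ultimately show "\<phi> (s + t' - t) (\<phi> 1 (\<phi> t x)) \<in> H (v (int n + 1))"
        using proj_mem by (metis of_nat_Suc add.commute)
      show "\<bar>s + t' - t\<bar> \<le> 3 * \<tau> / 4"
        using S_bound[of "v (int n)" x] S_bound[of "q (int (Suc n))" "\<phi> 1 x"]
          S_bound[of "v (int (Suc n))" x'] unfolding s_def t_def t'_def by linarith
    qed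
    then have "hol 1 v (Suc n) w = S b w + hol 1 q n w' + t + 1 + (s + t' - t)"
      unfolding hol_Suc pv Suc by (simp add: t_def x_def add.commute)
    moreover have "hol 1 q (Suc n) w' = hol 1 q n w' + 1 + s"
      by (simp add: hol_Suc s_def x_def)
    ultimately show ?case by (simp add: t'_def x'_def)
  qed
  then show ?thesis
    unfolding pt_def[of 1 v] by (simp add: proj_def pt_def w' add_ac)
qed

end

section \<open>Trapping regions of a return map\<close>

context expansive_section_flow begin

text \<open>\<open>pt 1 q m\<close> is the return map over one period of the base. That
  \<open>V\<close> contains a neighbourhood of \<open>q 0\<close> in the section is kept apart, as
  the radius \<open>\<delta>\<close> in \<open>trap_exists\<close>.\<close>

definition trap :: "real \<Rightarrow> (int \<Rightarrow> 'a) \<Rightarrow> nat \<Rightarrow> 'a set \<Rightarrow> bool" where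
  "trap \<epsilon> q m V \<longleftrightarrow> 0 < m \<and> (\<forall>j. q (j + int m) = q j) \<and> continuum V \<and> V \<subseteq> H (q 0) \<and>
     pt 1 q m ` V \<subseteq> V \<and> (\<forall>w\<in>V. \<forall>k. dist (q (int k)) (pt 1 q k w) \<le> \<epsilon>)"

text \<open>An accumulation point of the backward orbit provides two close times \<open>- n2\<close>
  and \<open>- n1\<close>; the return map contracts \<open>V\<close> to a set so small that the
  closing jump cannot carry it out of \<open>V\<close>. The last claim records further close
  returns, which later place \<open>u 0\<close> on the attractor.\<close>

lemma trap_exists:
  assumes u: "stab u" and e: "0 < \<epsilon>" "\<epsilon> \<le> \<rho>1" and k: "0 < \<kappa>"
  obtains q m V \<delta> where "pseudo \<kappa> q" "trap \<epsilon> q m V" "0 < \<delta>"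
    "\<And>w. w \<in> H (q 0) \<Longrightarrow> dist (q 0) w \<le> \<delta> \<Longrightarrow> w \<in> V"
    "\<And>M. \<exists>n\<ge>M. proj (q 0) (u (- int n)) \<in> V"
proof -
  obtain \<delta> N where del: "0 < \<delta>" and N:
    "\<And>n. N \<le> n \<Longrightarrow> \<exists>V. continuum V \<and> V \<subseteq> H (u (- int n)) \<and>
        (\<forall>w\<in>H (u (- int n)). dist (u (- int n)) w \<le> \<delta> \<longrightarrow> w \<in> V) \<and>
        (\<forall>w\<in>V. \<forall>k. dist (u (int k - int n)) (pt 1 (\<lambda>j. u (j - int n)) k w) \<le> \<epsilon>)"
    using stab_backward_uniform[OF u e] by blast
  have ps: "pseudo (r0/2) u" and step: "\<And>j. j < 0 \<Longrightarrow> u (j + 1) = \<phi> 1 (u j)"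
    using u by (simp_all add: stab_def)
  obtain d1 where d1: "0 < d1"
    "\<And>x y v w. \<lbrakk>dist x y \<le> d1; dist v w \<le> d1\<rbrakk> \<Longrightarrow> dist (proj x v) (proj y w) \<le> \<delta>"
    using proj_uniform[OF del] by blast
  have h0: "0 < min d1 r0 / 2" using d1 r0 by simp
  obtain \<sigma> where sig: "0 < \<sigma>"
    "\<And>s s' v w. \<lbrakk>\<bar>s\<bar> \<le> 2; \<bar>s'\<bar> \<le> 2; \<bar>s - s'\<bar> \<le> \<sigma>; dist v w \<le> \<sigma>\<rbrakk> \<Longrightarrow> dist (\<phi> s v) (\<phi> s' w) \<le> min d1 r0 / 2"
    using phi_uniform[OF h0] by blast
  obtain d2 where d2: "0 < d2"
    "\<And>s s' v w. \<lbrakk>\<bar>s\<bar> \<le> 2; \<bar>s'\<bar> \<le> 2; \<bar>s - s'\<bar> \<le> d2; dist v w \<le> d2\<rbrakk> \<Longrightarrow> dist (\<phi> s v) (\<phi> s' w) \<le> \<kappa>"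
    using phi_uniform[OF k] by blast
  \<comment> \<open>The size of the closing jump: half of \<open>min d1 r0\<close> is left for the
    contracted image, \<open>\<kappa>\<close> bounds the jump forwards, and \<open>d2\<close> bounds
    it after applying \<open>\<phi> (-1)\<close>, that is, backwards.\<close>
  define g where "g = min (min (min d1 r0 / 2) \<kappa>) d2"
  have g: "0 < g" "g \<le> min d1 r0 / 2" "g \<le> \<kappa>" "g \<le> d2" using h0 k d2 by (auto simp: g_def)
  obtain M where M: "\<And>u A n x y. \<lbrakk>pseudo (r0/2) u; continuum A; A \<subseteq> H (u 0); M \<le> n;
       \<And>z k. \<lbrakk>z \<in> A; k \<le> n + M\<rbrakk> \<Longrightarrow> dist (u (int k)) (pt 1 u k z) \<le> \<rho>1; x \<in> A; y \<in> A\<rbrakk>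
       \<Longrightarrow> dist (pt 1 u n x) (pt 1 u n y) \<le> \<sigma>"
    using forward_contraction[OF sig(1)] by blast
  obtain y r where r: "strict_mono (r :: nat \<Rightarrow> nat)" "((\<lambda>n. u (- int n)) \<circ> r) \<longlonglongrightarrow> y"
    using comp unfolding compact_def by (metis UNIV_I)
  obtain i0 where i0: "\<And>i. i0 \<le> i \<Longrightarrow> dist (u (- int (r i))) y < g/2"
    using metric_LIMSEQ_D[OF r(2), of "g/2"] g(1) by auto
  have near: "dist (u (- int (r i))) (u (- int (r j))) \<le> g" if "i0 \<le> i" "i0 \<le> j" for i j
    using i0[OF that(1)] i0[OF that(2)] dist_triangle_half_l[of "u (- int (r i))" y g] by fastforce
  have rge: "i \<le> r i" for i using r(1) by (rule seq_suble)
  define n1 where "n1 = r (max i0 N)"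
  \<comment> \<open>\<open>M\<close> and the extra \<open>1\<close> give
    \<open>M \<le> m - 1\<close>, so the contraction acts before the last step of the period;
    \<open>N\<close> places \<open>n2\<close> in the range of uniform stability.\<close>
  define i2 where "i2 = max i0 (n1 + M + N + 1)"
  define n2 where "n2 = r i2"
  have n2: "n1 + M + N + 1 \<le> n2" using rge[of i2] by (simp add: n2_def i2_def)
  define m where "m = n2 - n1"
  have m: "0 < m" "M \<le> m - 1" "int m = int n2 - int n1" using n2 by (auto simp: m_def)
  define b where "b = u (- int n2)"
  define u' where "u' j = u (j - int n2)" for j
  \<comment> \<open>closing up the orbit segment from \<open>u (- n2)\<close> to \<open>u (- n1)\<close>\<close>
  define q where "q j = u' (j mod int m)" for j
  have q0: "q 0 = b" by (simp add: q_def u'_def b_def)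
  have qper: "q (j + int m) = q j" for j by (simp add: q_def)
  have qu: "q (int k) = u' (int k)" if "k < m" for k using that by (simp add: q_def)
  have bn1: "dist (u (- int n1)) b \<le> g"
    unfolding n1_def b_def n2_def by (rule near) (auto simp: i2_def)
  have psq: "pseudo \<kappa> q"
    unfolding pseudo_def
  proof
    fix j
    define i where "i = j mod int m"
    have i: "0 \<le> i" "i < int m" using m by (auto simp: i_def)
    have si: "\<phi> 1 (u' i) = u' (i + 1)"
      using step[of "i - int n2"] i m by (simp add: u'_def algebra_simps)
    have m1: "(j + 1) mod int m = (i + 1) mod int m" by (simp add: i_def mod_add_left_eq)
    show "dist (\<phi> 1 (q j)) (q (j + 1)) \<le> \<kappa> \<and> dist (\<phi> (- 1) (q (j + 1))) (q j) \<le> \<kappa>"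
    proof (cases "i + 1 = int m")
      case True
      then have q1: "q (j + 1) = b" using m1 by (simp add: q_def u'_def b_def)
      have a: "\<phi> 1 (q j) = u (- int n1)" using si True m by (simp add: q_def i_def u'_def)
      then have "\<phi> (-1) (u (- int n1)) = q j" by (metis phi_add add.left_inverse phi0)
      moreover have "dist (\<phi> (-1) b) (\<phi> (-1) (u (- int n1))) \<le> \<kappa>"
        using bn1 g d2(1) by (intro d2(2)) (auto simp: dist_commute)
      ultimately show ?thesis using a q1 bn1 g by simp
    next
      case False
      then have "(i + 1) mod int m = i + 1" using i by simp
      then have "q (j + 1) = \<phi> 1 (q j)" using m1 si by (simp add: q_def i_def)
      then show ?thesis using k by simp
    qed
  qed
  obtain V where V: "continuum V" "V \<subseteq> H b" "\<And>w. w \<in> H b \<Longrightarrow> dist b w \<le> \<delta> \<Longrightarrow> w \<in> V"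
    and Vu': "\<And>w k. w \<in> V \<Longrightarrow> dist (u' (int k)) (pt 1 u' k w) \<le> \<epsilon>"
    using N[of n2] n2 unfolding u'_def[abs_def] b_def by auto
  have ptq: "pt 1 q k w = pt 1 u' k w" if "k < m" for k w
    by (rule pt_cong) (use that qu in simp)
  have projV: "proj b x \<in> V" if "dist b x \<le> min d1 r0" for x
  proof (rule V(3))
    show "proj b x \<in> H b" using that by (intro proj_mem) simp
    show "dist b (proj b x) \<le> \<delta>" using d1(2)[of b b b x] that d1(1) by simp
  qed
  have bV: "b \<in> V" using projV[of b] d1 r0 by simp
  have ps': "pseudo (r0/2) u'"
    using pseudo_shift[OF ps, of "- int n2"] by (simp add: u'_def[abs_def])
  \<comment> \<open>Contraction is applied at step \<open>m - 1\<close>. The last step is done by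
    hand, because there \<open>q\<close> jumps from \<open>u (- n1)\<close> to
    \<open>b\<close>.\<close>
  have GV: "pt 1 q m w \<in> V" if w: "w \<in> V" for w
  proof -
    obtain i where i: "m = Suc i" using m by (cases m) auto
    have "dist (pt 1 u' i b) (pt 1 u' i w) \<le> \<sigma>"
    proof (rule M[OF ps' V(1)])
      show "V \<subseteq> H (u' 0)" using V(2) by (simp add: u'_def b_def)
      show "M \<le> i" using m i by simp
      show "dist (u' (int k)) (pt 1 u' k z) \<le> \<rho>1" if "z \<in> V" for z k
        using Vu'[OF that, of k] e by linarith
    qed (use bV w in auto)
    moreover have "pt 1 u' i b = u' (int i)"
      using stab_pt_base[OF u] by (simp add: u'_def[abs_def] b_def)
    ultimately have "dist (\<phi> 1 (u' (int i))) (\<phi> 1 (pt 1 u' i w)) \<le> min d1 r0 / 2"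
      using sig(1) by (intro sig(2)) auto
    moreover have "\<phi> 1 (u' (int i)) = u (- int n1)"
    proof -
      have "int i - int n2 < 0" "int i - int n2 + 1 = - int n1" using m(3) i by simp_all
      then show ?thesis using step[of "int i - int n2"] by (simp add: u'_def)
    qed
    ultimately have "dist b (\<phi> 1 (pt 1 u' i w)) \<le> min d1 r0"
      using bn1 g(2) dist_triangle[of b "\<phi> 1 (pt 1 u' i w)" "u (- int n1)"] by (simp add: dist_commute)
    then have "proj b (\<phi> 1 (pt 1 u' i w)) \<in> V" by (rule projV)
    moreover have "q (1 * int (Suc i)) = b" using qper[of 0] q0 i by simp
    ultimately show ?thesis unfolding i pt_Suc using ptq[of i w] i by simp
  qed
  have track: "dist (q (int k)) (pt 1 q k w) \<le> \<epsilon>" if "w \<in> V" for k w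
    using that
  proof (induction k arbitrary: w rule: less_induct)
    case (less k)
    show ?case
    proof (cases "k < m")
      case True
      then show ?thesis using Vu'[OF less(2), of k] qu ptq by simp
    next
      case False
      then have k: "k = m + (k - m)" by simp
      have "pt 1 q (m + (k - m)) w = pt 1 q (k - m) (pt 1 q m w)"
        unfolding pt_add[of 1 q m] by (simp add: qper)
      moreover have "q (int k) = q (int (k - m))" using qper[of "int (k - m)"] False by (simp add: of_nat_diff)
      ultimately show ?thesis using less(1)[of "k - m" "pt 1 q m w"] GV[OF less(2)] k m by simp
    qed
  qed
  show ?thesis
  proof (rule that[of q m V \<delta>])
    show "trap \<epsilon> q m V" using m(1) qper V(1,2) GV track by (auto simp: trap_def q0)
    show "\<exists>n\<ge>L. proj (q 0) (u (- int n)) \<in> V" for L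
    proof (intro exI conjI)
      show "L \<le> r (max i0 L)" using rge[of "max i0 L"] by simp
      have "dist b (u (- int (r (max i0 L)))) \<le> g"
        unfolding b_def n2_def by (rule near) (auto simp: i2_def)
      then show "proj (q 0) (u (- int (r (max i0 L)))) \<in> V"
        unfolding q0 using g h0 by (intro projV) auto
    qed
  qed (use psq V(3) del q0 in auto)
qed

lemma trap_contraction:
  assumes "trap \<epsilon> q m V" "pseudo (r0/2) q" "\<epsilon> \<le> \<rho>1" "0 < \<sigma>"
  obtains N where "\<And>n x y. \<lbrakk>N \<le> n; x \<in> V; y \<in> V\<rbrakk> \<Longrightarrow> dist (pt 1 q n x) (pt 1 q n y) \<le> \<sigma>"
proof -
  obtain M where M: "\<And>u A n x y. \<lbrakk>pseudo (r0/2) u; continuum A; A \<subseteq> H (u 0); M \<le> n;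
       \<And>z k. \<lbrakk>z \<in> A; k \<le> n + M\<rbrakk> \<Longrightarrow> dist (u (int k)) (pt 1 u k z) \<le> \<rho>1; x \<in> A; y \<in> A\<rbrakk>
       \<Longrightarrow> dist (pt 1 u n x) (pt 1 u n y) \<le> \<sigma>"
    using forward_contraction[OF assms(4)] by blast
  show ?thesis
  proof (rule that[of M])
    show "dist (pt 1 q n x) (pt 1 q n y) \<le> \<sigma>" if n: "M \<le> n" and xy: "x \<in> V" "y \<in> V" for n x y
    proof (rule M[OF assms(2) _ _ n _ xy])
      show "dist (q (int k)) (pt 1 q k z) \<le> \<rho>1" if "z \<in> V" for z k
        using assms(1,3) that unfolding trap_def by (meson order_trans)
    qed (use assms(1) in \<open>auto simp: trap_def\<close>)
  qed
qed

text \<open>Let \<open>p\<close> minimise the displacement of the return map on \<open>V\<close>.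
  Applying \<open>N * m\<close> steps to \<open>p\<close> and to its image brings them within
  \<open>\<sigma>\<close> of each other, and this is again a displacement in \<open>V\<close>; so
  the minimum is at most every \<open>\<sigma>\<close>. The same contraction draws all of
  \<open>V\<close> to the orbit of \<open>p\<close>.\<close>

lemma trap_periodic_attractor:
  assumes trap: "trap \<epsilon> q m V" and ps: "pseudo (r0/2) q" and e: "\<epsilon> \<le> \<rho>1"
  obtains p T where "0 < T" "\<phi> T p = p"
    "\<forall>\<sigma>>0. \<exists>T0. \<forall>w\<in>V. \<forall>t\<ge>T0. \<exists>s. dist (\<phi> t w) (\<phi> s p) \<le> \<sigma>"
proof -
  have m: "0 < m" and qper: "\<And>j. q (j + int m) = q j" and V: "continuum V" "V \<subseteq> H (q 0)"
    and GV: "\<And>w. w \<in> V \<Longrightarrow> pt 1 q m w \<in> V"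
    using trap by (auto simp: trap_def)
  have pt_m: "pt 1 q (m + k) w = pt 1 q k (pt 1 q m w)" for k w
    unfolding pt_add[of 1 q m] by (simp add: qper)
  have qper': "q (j + int (i * m)) = q j" for i j
  proof (induction i)
    case (Suc i)
    have "q (j + int (Suc i * m)) = q (j + int (i * m) + int m)" by (simp add: algebra_simps)
    then show ?case using qper Suc by simp
  qed simp
  have pt_im: "pt 1 q (i * m + k) w = pt 1 q k (pt 1 q (i * m) w)" for i k w
    unfolding pt_add[of 1 q "i * m"] by (simp add: qper' del: of_nat_mult)
  have GiV: "pt 1 q (i * m) w \<in> V" if "w \<in> V" for i w
    using that by (induction i arbitrary: w) (auto simp: pt_m GV)
  have "\<exists>p\<in>V. \<forall>v\<in>V. dist p (pt 1 q m p) \<le> dist v (pt 1 q m v)"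
    using V(1) unfolding continuum_def
    by (intro continuous_attains_inf) (auto intro!: continuous_intros pt_continuous_on)
  then obtain p where p: "p \<in> V" "\<And>v. v \<in> V \<Longrightarrow> dist p (pt 1 q m p) \<le> dist v (pt 1 q m v)" by blast
  have "dist p (pt 1 q m p) \<le> 0 + \<sigma>" if s: "0 < \<sigma>" for \<sigma>
  proof -
    obtain N where N: "\<And>n x y. \<lbrakk>N \<le> n; x \<in> V; y \<in> V\<rbrakk> \<Longrightarrow> dist (pt 1 q n x) (pt 1 q n y) \<le> \<sigma>"
      using trap_contraction[OF trap ps e s] by blast
    have "dist p (pt 1 q m p) \<le> dist (pt 1 q (N * m) p) (pt 1 q m (pt 1 q (N * m) p))"
      by (intro p(2) GiV p(1))
    also have "pt 1 q m (pt 1 q (N * m) p) = pt 1 q (N * m) (pt 1 q m p)"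
      by (metis add.commute pt_im pt_m)
    also have "dist (pt 1 q (N * m) p) (pt 1 q (N * m) (pt 1 q m p)) \<le> \<sigma>"
      using m by (intro N p(1) GV) simp
    finally show ?thesis by simp
  qed
  then have "dist p (pt 1 q m p) \<le> 0" by (rule field_le_epsilon)
  then have fixp: "pt 1 q m p = p" by simp
  show ?thesis
  proof (rule that[of "hol 1 q m p" p])
    show "0 < hol 1 q m p" using hol_bounds(1)[where n = m and u = q and y = p] m
      by (smt (verit) mult_pos_pos of_nat_0_less_iff divide_pos_pos)
    show "\<phi> (hol 1 q m p) p = p" using fixp by (simp add: pt_def)
    show "\<forall>\<sigma>>0. \<exists>T0. \<forall>w\<in>V. \<forall>t\<ge>T0. \<exists>s. dist (\<phi> t w) (\<phi> s p) \<le> \<sigma>"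
    proof (intro allI impI)
      fix \<sigma> :: real assume "0 < \<sigma>"
      then obtain d where d: "0 < d"
        "\<And>s s' v w. \<lbrakk>\<bar>s\<bar> \<le> 2; \<bar>s'\<bar> \<le> 2; \<bar>s - s'\<bar> \<le> d; dist v w \<le> d\<rbrakk> \<Longrightarrow> dist (\<phi> s v) (\<phi> s' w) \<le> \<sigma>"
        using phi_uniform by blast
      obtain N where N: "\<And>n x y. \<lbrakk>N \<le> n; x \<in> V; y \<in> V\<rbrakk> \<Longrightarrow> dist (pt 1 q n x) (pt 1 q n y) \<le> d"
        using trap_contraction[OF trap ps e d(1)] by blast
      \<comment> \<open>Each step lasts at most \<open>9/8\<close>, so at least \<open>N\<close>
        hits precede \<open>t\<close>; the time since the last hit is in the range of
        \<open>phi_uniform\<close>.\<close>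
      have near: "\<exists>s. dist (\<phi> t w) (\<phi> s p) \<le> \<sigma>" if w: "w \<in> V" and t: "9/8 * real (Suc N) < t" for w t
      proof -
        have "0 \<le> t" using t by (smt (verit) of_nat_0_le_iff mult_nonneg_nonneg divide_nonneg_nonneg)
        then obtain k where k: "hol 1 q k w \<le> t" "t \<le> hol 1 q (Suc k) w" using hol_bracket by blast
        have "9/8 * real (Suc N) < 9/8 * real (Suc k)"
          using hol_bounds(2)[of q "Suc k" w] k(2) t by linarith
        then have "N \<le> k" by simp
        define s where "s = t - hol 1 q k w"
        have "S (q (1 * int (Suc k))) (\<phi> (of_int 1) (pt 1 q k w)) \<le> 1"
          using S_bound[of "q (1 * int (Suc k))" "\<phi> (of_int 1) (pt 1 q k w)"] tau by linarith
        then have "\<bar>s\<bar> \<le> 2" using k unfolding s_def hol_Suc of_int_1 by linarith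
        then have "dist (\<phi> s (pt 1 q k w)) (\<phi> s (pt 1 q k p)) \<le> \<sigma>"
          using N[OF \<open>N \<le> k\<close> w p(1)] d(1) by (intro d(2)) auto
        moreover have "\<phi> s (pt 1 q k w) = \<phi> t w" by (simp add: s_def pt_def)
        moreover have "\<phi> s (pt 1 q k p) = \<phi> (s + hol 1 q k p) p" by (simp add: pt_def)
        ultimately show ?thesis by auto
      qed
      show "\<exists>T0. \<forall>w\<in>V. \<forall>t\<ge>T0. \<exists>s. dist (\<phi> t w) (\<phi> s p) \<le> \<sigma>"
      proof (rule exI[of _ "9/8 * real (Suc N) + 1"], rule ballI, rule allI, rule impI)
        fix w t assume "w \<in> V" "9/8 * real (Suc N) + 1 \<le> t"
        then show "\<exists>s. dist (\<phi> t w) (\<phi> s p) \<le> \<sigma>" by (intro near) linarith+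
      qed
    qed
  qed
qed

text \<open>Near \<open>z\<close>, the first \<open>N\<close> steps along \<open>q\<close> are
  controlled by equicontinuity and all later ones by contraction of \<open>V\<close>;
  \<open>base_change\<close> turns this into stability over a base through \<open>z\<close>. The
  value \<open>r0/6\<close> appears because one step of that base is compared with \<open>q\<close>
  by three distances, which add up to \<open>r0/2\<close>.\<close>

lemma trap_stab:
  assumes trap: "trap \<epsilon> q m V" and ps: "pseudo (r0/6) q" and e: "\<epsilon> \<le> \<rho>1" "\<epsilon> \<le> r0/6"
    and e_step: "\<And>v w d. \<lbrakk>dist v w \<le> \<epsilon>; d \<in> {1, -1}\<rbrakk> \<Longrightarrow> dist (\<phi> d v) (\<phi> d w) \<le> r0/6"
    and del: "\<And>w. w \<in> H (q 0) \<Longrightarrow> dist (q 0) w \<le> \<delta> \<Longrightarrow> w \<in> V"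
    and z: "z \<in> H (q 0)" "dist (q 0) z < \<delta>"
  shows "\<exists>v. stab v \<and> v 0 = z"
proof -
  have ps2: "pseudo (r0/2) q" using pseudo_mono[OF ps] r0 by simp
  have zV: "z \<in> V" using z del by simp
  have track: "dist (q (int k)) (pt 1 q k w) \<le> \<epsilon>" if "w \<in> V" for k w
    using trap that by (auto simp: trap_def)
  define b where "b = q 0"
  \<comment> \<open>Forwards \<open>v\<close> samples the orbit of \<open>z\<close> at its hits with
    the sections along \<open>q\<close>, at irregular times; backwards it uses integer times, as
    \<open>stab\<close> requires.\<close>
  define v where "v j = (if 0 \<le> j then pt 1 q (nat j) z else \<phi> (of_int j) z)" for j
  have v0: "v 0 = z" by (simp add: v_def)
  have vn: "v (int n) = pt 1 q n z" for n by (simp add: v_def)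
  have vneg: "v (j + 1) = \<phi> 1 (v j)" if "j < 0" for j
    using that by (cases "j = -1") (auto simp: v_def add.commute)
  have psv: "pseudo (r0/2) v"
    unfolding pseudo_def
  proof
    fix j
    show "dist (\<phi> 1 (v j)) (v (j + 1)) \<le> r0/2 \<and> dist (\<phi> (- 1) (v (j + 1))) (v j) \<le> r0/2"
    proof (cases "j < 0")
      case True
      then show ?thesis using vneg r0 by simp
    next
      case False
      then obtain n where n: "j = int n" by (metis nonneg_int_cases not_less)
      have q: "dist (q j) (v j) \<le> \<epsilon>" "dist (q (j + 1)) (v (j + 1)) \<le> \<epsilon>"
        using track[OF zV, of n] track[OF zV, of "Suc n"] vn[of n] vn[of "Suc n"] n
        by (simp_all add: add.commute)
      have qq: "dist (\<phi> 1 (q j)) (q (j + 1)) \<le> r0/6" "dist (\<phi> (- 1) (q (j + 1))) (q j) \<le> r0/6"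
        using ps by (auto simp: pseudo_def)
      have a: "dist (\<phi> 1 (q j)) (\<phi> 1 (v j)) \<le> r0/6" "dist (\<phi> (-1) (q (j + 1))) (\<phi> (-1) (v (j + 1))) \<le> r0/6"
        using e_step[OF q(1), of 1] e_step[OF q(2), of "-1"] by auto
      have tri: "dist A D \<le> r0/2"
        if "dist B A \<le> r0/6" "dist B C \<le> r0/6" "dist C D \<le> r0/6" for A B C D :: 'a
        using that dist_triangle[of A D B] dist_triangle[of B D C] by (simp add: dist_commute)
      show ?thesis
        using tri[OF a(1) qq(1)] tri[OF a(2) qq(2)] q e(2) by auto
    qed
  qed
  have "0 < \<rho>" using rho by simp
  then obtain d0 where d0: "0 < d0"
    "\<And>x y v w. \<lbrakk>dist x y \<le> d0; dist v w \<le> d0\<rbrakk> \<Longrightarrow> dist (proj x v) (proj y w) \<le> \<rho>"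
    using proj_uniform by blast
  define \<rho>3 where "\<rho>3 = min d0 r0"
  have \<rho>3: "0 < \<rho>3" "\<rho>3 \<le> r0" "\<And>x y. dist x y \<le> \<rho>3 \<Longrightarrow> dist x (proj x y) \<le> \<rho>"
  proof -
    show "0 < \<rho>3" "\<rho>3 \<le> r0" using d0 r0 by (auto simp: \<rho>3_def)
    show "dist x (proj x y) \<le> \<rho>" if "dist x y \<le> \<rho>3" for x y
      using d0(2)[of x x x y] that d0(1) by (simp add: \<rho>3_def)
  qed
  have "\<exists>d>0. \<forall>w\<in>H (v 0). dist (v 0) w \<le> d \<longrightarrow> (\<forall>n. dist (v (int n)) (pt 1 v n w) \<le> \<epsilon>')"
    if "0 < \<epsilon>'" for \<epsilon>'
  proof -
    obtain d1 where d1: "0 < d1"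
      "\<And>x y v w. \<lbrakk>dist x y \<le> d1; dist v w \<le> d1\<rbrakk> \<Longrightarrow> dist (proj x v) (proj y w) \<le> \<epsilon>'"
      using proj_uniform[OF \<open>0 < \<epsilon>'\<close>] by blast
    define \<sigma> where "\<sigma> = min d1 \<rho>3"
    have sig: "0 < \<sigma>" "\<sigma> \<le> d1" "\<sigma> \<le> \<rho>3" using d1 \<rho>3 by (auto simp: \<sigma>_def)
    obtain N where N: "\<And>n x y. \<lbrakk>N \<le> n; x \<in> V; y \<in> V\<rbrakk> \<Longrightarrow> dist (pt 1 q n x) (pt 1 q n y) \<le> \<sigma>"
      using trap_contraction[OF trap ps2 e(1) sig(1)] by blast
    obtain d2 where d2: "0 < d2"
      "\<And>n u v w. \<lbrakk>n \<le> N; dist v w \<le> d2\<rbrakk> \<Longrightarrow> dist (pt 1 u n v) (pt 1 u n w) \<le> \<sigma>"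
      using pt_equicontinuous[of \<sigma> 1 N] sig(1) by auto
    \<comment> \<open>Since \<open>z\<close> is strictly within \<open>\<delta>\<close> of
      \<open>b\<close>, there is room for nearby points to project into \<open>V\<close>.\<close>
    have "0 < min d2 (\<delta> - dist b z)" using d2 z by (simp add: b_def)
    then obtain d3 where d3: "0 < d3"
      "\<And>x y v w. \<lbrakk>dist x y \<le> d3; dist v w \<le> d3\<rbrakk> \<Longrightarrow> dist (proj x v) (proj y w) \<le> min d2 (\<delta> - dist b z)"
      using proj_uniform by blast
    have bz: "dist b z \<le> r0/6" using track[OF zV, of 0] e by (simp add: b_def)
    have zfix: "proj b z = z" using z bz r0 by (intro proj_fix) (auto simp: b_def)
    have "dist (v (int n)) (pt 1 v n w) \<le> \<epsilon>'" if w: "w \<in> H z" "dist z w \<le> min d3 (r0/6)" for n w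
    proof -
      define w' where "w' = proj b w"
      have zw': "dist z w' \<le> min d2 (\<delta> - dist b z)"
        using d3(2)[of b b z w] w(2) d3(1) by (simp add: zfix w'_def)
      have "dist b w \<le> r0" using bz w(2) dist_triangle[of b w z] r0 by simp
      then have "w' \<in> H b" unfolding w'_def by (rule proj_mem)
      moreover have "dist b w' \<le> \<delta>" using zw' dist_triangle[of b w' z] by simp
      ultimately have w'V: "w' \<in> V" using del by (simp add: b_def)
      have near: "dist (v (int k)) (pt 1 q k w') \<le> \<sigma>" for k
        unfolding vn using N[OF _ zV w'V, of k] d2(2)[of k z w' q] zw' by (cases "k \<le> N") auto
      have "pt 1 v n w = proj (v (int n)) (pt 1 q n w')"
      proof (rule base_change[OF psv _ w'_def \<rho>3(3) \<rho>3(2)])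
        show "w \<in> H (v 0)" using w v0 by simp
        show "dist (v (int k)) (pt 1 q k w') \<le> \<rho>3" for k using near[of k] sig by simp
      qed
      moreover have "dist (proj (v (int n)) (v (int n))) (proj (v (int n)) (pt 1 q n w')) \<le> \<epsilon>'"
        using near[of n] sig d1(1) by (intro d1(2)) auto
      ultimately show ?thesis by simp
    qed
    then show ?thesis using d3(1) r0 v0 by (intro exI[of _ "min d3 (r0/6)"]) auto
  qed
  then have "stab v" using psv vneg unfolding stab_def by blast
  then show ?thesis using v0 by blast
qed

lemma stab_backward_orbit:
  assumes "stab u"
  shows "\<phi> (real n) (u (- int n)) = u 0"
proof (induction n)
  case (Suc n)
  have "\<forall>j<0. u (j + 1) = \<phi> 1 (u j)" using assms by (simp add: stab_def)
  then have "u (- int (Suc n) + 1) = \<phi> 1 (u (- int (Suc n)))"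
    by (elim allE[of _ "- int (Suc n)"]) simp
  then have "u (- int n) = \<phi> 1 (u (- int (Suc n)))" by simp
  then show ?case using Suc by (simp add: add.commute)
qed simp

text \<open>The point \<open>u 0\<close> is reached from points of \<open>V\<close> after
  arbitrarily long times, by the returns of its backward orbit. Attraction puts it in the closure of
  the periodic orbit, which is closed.\<close>

lemma stab_local_structure:
  assumes u: "stab u"
  obtains p T b \<delta> where "0 < T" "\<phi> T p = p" "u 0 \<in> range (\<lambda>t. \<phi> t p)" "0 < \<delta>"
    "\<And>z. \<lbrakk>z \<in> H b; dist b z < \<delta>\<rbrakk> \<Longrightarrow> \<exists>v. stab v \<and> v 0 = z"
    "\<And>z \<sigma>. \<lbrakk>z \<in> H b; dist b z < \<delta>; 0 < \<sigma>\<rbrakk> \<Longrightarrow> \<exists>T0. \<forall>t\<ge>T0. \<exists>s. dist (\<phi> t z) (\<phi> s p) \<le> \<sigma>"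
proof -
  have "0 < r0/6" using r0 by simp
  then obtain d where d: "0 < d"
    "\<And>s s' v w. \<lbrakk>\<bar>s\<bar> \<le> 2; \<bar>s'\<bar> \<le> 2; \<bar>s - s'\<bar> \<le> d; dist v w \<le> d\<rbrakk> \<Longrightarrow> dist (\<phi> s v) (\<phi> s' w) \<le> r0/6"
    using phi_uniform by blast
  define \<epsilon> where "\<epsilon> = min d (min \<rho>1 (r0/6))"
  have e: "0 < \<epsilon>" "\<epsilon> \<le> \<rho>1" "\<epsilon> \<le> r0/6" "\<epsilon> \<le> d" using d rho1 r0 by (auto simp: \<epsilon>_def)
  have e_step: "dist (\<phi> d' v) (\<phi> d' w) \<le> r0/6" if "dist v w \<le> \<epsilon>" "d' \<in> {1, -1}" for v w d'
    using that e(4) d(1) by (intro d(2)) auto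
  obtain q m V \<delta> where q: "pseudo (r0/6) q" "trap \<epsilon> q m V" "0 < \<delta>"
    and del: "\<And>w. w \<in> H (q 0) \<Longrightarrow> dist (q 0) w \<le> \<delta> \<Longrightarrow> w \<in> V"
    and ret: "\<And>M. \<exists>n\<ge>M. proj (q 0) (u (- int n)) \<in> V"
    using trap_exists[OF u e(1,2) \<open>0 < r0/6\<close>] by blast
  have ps2: "pseudo (r0/2) q" using pseudo_mono[OF q(1)] r0 by simp
  obtain p T where p: "0 < T" "\<phi> T p = p"
    and attr': "\<forall>\<sigma>>0. \<exists>T0. \<forall>w\<in>V. \<forall>t\<ge>T0. \<exists>s. dist (\<phi> t w) (\<phi> s p) \<le> \<sigma>"
    by (rule trap_periodic_attractor[OF q(2) ps2 e(2)])
  have "u 0 \<in> range (\<lambda>t. \<phi> t p)"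
  proof -
    have "\<exists>y\<in>range (\<lambda>t. \<phi> t p). dist y (u 0) < \<sigma>" if s: "0 < \<sigma>" for \<sigma>
    proof -
      have s2: "0 < \<sigma>/2" using s by simp
      obtain T0 where T0: "\<forall>w\<in>V. \<forall>t\<ge>T0. \<exists>s. dist (\<phi> t w) (\<phi> s p) \<le> \<sigma>/2"
        using attr'[rule_format, OF s2] by (elim exE)
      \<comment> \<open>The extra \<open>1\<close> absorbs the section time \<open>s\<close> spent
        on projecting to \<open>V\<close>.\<close>
      obtain n where n: "nat \<lceil>T0\<rceil> + 1 \<le> n" "proj (q 0) (u (- int n)) \<in> V" using ret by blast
      define s where "s = S (q 0) (u (- int n))"
      have "s \<le> 1" using S_bound[of "q 0" "u (- int n)"] tau by (auto simp: s_def)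
      moreover have "T0 \<le> real n - 1" using n(1) by linarith
      ultimately have "T0 \<le> real n - s" by simp
      then obtain s' where "dist (\<phi> (real n - s) (proj (q 0) (u (- int n)))) (\<phi> s' p) \<le> \<sigma>/2"
        using T0 n(2) by blast
      moreover have "\<phi> (real n - s) (proj (q 0) (u (- int n))) = u 0"
        by (simp add: proj_def s_def[symmetric] stab_backward_orbit[OF u])
      ultimately have "dist (\<phi> s' p) (u 0) < \<sigma>" using s by (simp add: dist_commute)
      then show ?thesis by blast
    qed
    then have "u 0 \<in> closure (range (\<lambda>t. \<phi> t p))"
      unfolding closure_approachable by (intro allI impI)
    then show ?thesis using closed_periodic_orbit[OF p(2,1)] by simp
  qed
  then show ?thesis
  proof (rule that[OF p _ q(3)])
    fix z assume z: "z \<in> H (q 0)" "dist (q 0) z < \<delta>"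
    show "\<exists>v. stab v \<and> v 0 = z"
      using trap_stab[OF q(2,1) e(2,3) e_step del z] by blast
    show "\<exists>T0. \<forall>t\<ge>T0. \<exists>s. dist (\<phi> t z) (\<phi> s p) \<le> \<sigma>" if s: "0 < \<sigma>" for \<sigma>
    proof -
      obtain T0 where "\<forall>w\<in>V. \<forall>t\<ge>T0. \<exists>s. dist (\<phi> t w) (\<phi> s p) \<le> \<sigma>"
        using attr'[rule_format, OF s] by (elim exE)
      moreover have "z \<in> V" using del[of z] z by simp
      ultimately show ?thesis by (intro exI[of _ T0]) simp
    qed
  qed
qed

end

subsection \<open>The circle\<close>

text \<open>An orbit cannot return to its own section within time \<open>\<tau>\<close>. Positive
  periods are thus bounded away from \<open>0\<close>, and a least one exists.\<close>

lemma (in section_flow) short_period_trivial: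
  assumes "\<phi> t x = x" "\<bar>t\<bar> \<le> \<tau>"
  shows "t = 0"
  using unique[of x x t] assms self by simp

text \<open>Over the least period \<open>R\<close> the orbit closes up without earlier repetition,
  so rescaling it to the unit interval gives a simple closed path.\<close>

lemma (in section_flow) periodic_orbit_homeomorphic_circle:
  assumes "\<phi> T p = p" "0 < T"
  shows "range (\<lambda>t. \<phi> t p) homeomorphic sphere (0::complex) 1"
proof -
  define P where "P = {t. \<tau> \<le> t \<and> \<phi> t p = p}"
  have P: "t \<in> P" if "\<phi> t p = p" "0 < t" for t
  proof (cases "t \<le> \<tau>")
    case True
    then show ?thesis using short_period_trivial[OF that(1)] that by simp
  qed (use that in \<open>simp add: P_def\<close>)
  have "P = {\<tau>..} \<inter> {t. \<phi> t p = p}" by (auto simp: P_def)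
  moreover have "closed {t. \<phi> t p = p}"
  proof -
    have "{t. \<phi> t p = p} = (\<lambda>t. \<phi> t p) -` {p}" by auto
    moreover have "continuous_on UNIV (\<lambda>t. \<phi> t p)" by (intro continuous_intros)
    ultimately show ?thesis by (simp add: closed_vimage)
  qed
  ultimately have "closed P" by auto
  moreover have bb: "bdd_below P" by (intro bdd_belowI[of _ \<tau>]) (auto simp: P_def)
  ultimately have inP: "Inf P \<in> P" using P[OF assms] by (intro closed_contains_Inf) auto
  define R where "R = Inf P"
  have R: "0 < R" "\<phi> R p = p" using inP tau by (auto simp: P_def R_def)
  have Rle: "R \<le> t" if "\<phi> t p = p" "0 < t" for t
    unfolding R_def by (rule cInf_lower[OF P[OF that] bb])
  define \<gamma> where "\<gamma> s = \<phi> (R * s) p" for s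
  have inj: "x = 0 \<and> y = 1" if xy: "x \<in> {0..1}" "y \<in> {0..1}" "x < y" "\<gamma> x = \<gamma> y" for x y
  proof -
    have "\<phi> (R * y - R * x) p = \<phi> (- (R * x)) (\<gamma> y)" by (simp add: \<gamma>_def)
    also have "\<dots> = \<phi> (- (R * x)) (\<gamma> x)" using xy(4) by simp
    also have "\<dots> = p" by (simp add: \<gamma>_def)
    finally have "R \<le> R * y - R * x" using R(1) xy(3) by (intro Rle) auto
    then have "R * 1 \<le> R * (y - x)" by (simp add: right_diff_distrib)
    then have "1 \<le> y - x" using R(1) mult_le_cancel_left_pos by blast
    then show ?thesis using xy by auto
  qed
  have "simple_path \<gamma>"
    unfolding simple_path_def loop_free_def
  proof (intro conjI ballI impI)
    show "path \<gamma>" unfolding path_def \<gamma>_def by (intro continuous_intros)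
    fix x y :: real assume "x \<in> {0..1}" "y \<in> {0..1}" "\<gamma> x = \<gamma> y"
    then show "x = y \<or> x = 0 \<and> y = 1 \<or> x = 1 \<and> y = 0"
      using inj[of x y] inj[of y x] by (cases x y rule: linorder_cases) auto
  qed
  moreover have "pathfinish \<gamma> = pathstart \<gamma>"
    using R by (simp add: pathfinish_def pathstart_def \<gamma>_def)
  ultimately have "path_image \<gamma> homeomorphic sphere (0::complex) 1"
    by (intro homeomorphic_simple_path_image_circle) auto
  moreover have "path_image \<gamma> = range (\<lambda>t. \<phi> t p)"
  proof -
    have "(*) R ` {0..1} = {0..R}" using R(1) by (simp add: image_mult_atLeastAtMost)
    then have "(\<lambda>t. \<phi> t p) ` {0..R} = (\<lambda>t. \<phi> t p) ` (*) R ` {0..1}" by simp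
    also have "\<dots> = path_image \<gamma>" by (simp add: path_image_def \<gamma>_def[abs_def] image_image)
    finally show ?thesis using periodic_orbit_eq[OF R(2,1)] by simp
  qed
  ultimately show ?thesis by simp
qed

context expansive_section_flow begin

lemma stab_imp_circle:
  assumes u: "stab u" and conn: "connected (UNIV :: 'a set)"
  shows "(UNIV :: 'a set) homeomorphic sphere (0::complex) 1"
proof -
  obtain p T b \<delta> where p: "0 < T" "\<phi> T p = p" and del: "0 < \<delta>"
    and st: "\<And>z. \<lbrakk>z \<in> H b; dist b z < \<delta>\<rbrakk> \<Longrightarrow> \<exists>v. stab v \<and> v 0 = z"
    and attr: "\<And>z \<sigma>. \<lbrakk>z \<in> H b; dist b z < \<delta>; 0 < \<sigma>\<rbrakk> \<Longrightarrow> \<exists>T0. \<forall>t\<ge>T0. \<exists>s. dist (\<phi> t z) (\<phi> s p) \<le> \<sigma>"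
    by (rule stab_local_structure[OF u]) (rule that)
  define orb where "orb = range (\<lambda>t. \<phi> t p)"
  have cl: "closed orb" unfolding orb_def by (rule closed_periodic_orbit[OF p(2,1)])
  have orb_phi: "\<phi> s x \<in> orb" if "x \<in> orb" for s x
    using that by (auto simp: orb_def)
  have sec: "z \<in> orb" if z: "z \<in> H b" "dist b z < \<delta>" for z
  proof -
    obtain v where v: "stab v" "v 0 = z" using st[OF z] by blast
    obtain p' T' where p': "0 < T'" "\<phi> T' p' = p'" "v 0 \<in> range (\<lambda>t. \<phi> t p')"
      by (rule stab_local_structure[OF v(1)]) (rule that)
    obtain s where s: "z = \<phi> s p'" using p'(3) v(2) by auto
    have "\<phi> T' z = \<phi> s (\<phi> T' p')" by (simp add: s add.commute)
    then have per: "\<phi> T' z = z" by (simp only: p'(2) s)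
    \<comment> \<open>Attraction is evaluated at a multiple of the period of \<open>z\<close> beyond
      \<open>T0\<close>, when \<open>z\<close> is back at itself.\<close>
    have "\<exists>y\<in>orb. dist y z < e" if e: "0 < e" for e
    proof -
      have "0 < e/2" using e by simp
      from attr[OF z this] obtain T0 where T0: "\<forall>t\<ge>T0. \<exists>s. dist (\<phi> t z) (\<phi> s p) \<le> e/2"
        by (elim exE)
      define k where "k = \<lceil>T0 / T'\<rceil>"
      have "T0 / T' \<le> of_int k" by (simp add: k_def)
      then have "T0 \<le> of_int k * T'" using p'(1) by (simp add: field_simps)
      then obtain s where "dist (\<phi> (of_int k * T') z) (\<phi> s p) \<le> e/2" using T0 by auto
      then have "dist (\<phi> s p) z < e" using e by (simp add: period_multiple[OF per] dist_commute)
      then show ?thesis unfolding orb_def by (rule bexI) simp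
    qed
    then have "z \<in> closure orb" unfolding closure_approachable by (intro allI impI)
    then show ?thesis using cl by simp
  qed
  have "0 < \<delta>/2" using del by simp
  then obtain d where d: "0 < d"
    "\<And>x y v w. \<lbrakk>dist x y \<le> d; dist v w \<le> d\<rbrakk> \<Longrightarrow> dist (proj x v) (proj y w) \<le> \<delta>/2"
    using proj_uniform by blast
  define g where "g = min d r0"
  have g: "0 < g" using d r0 by (simp add: g_def)
  have ball: "ball b g \<subseteq> orb"
  proof
    fix y assume y: "y \<in> ball b g"
    have "proj b y \<in> orb"
    proof (rule sec)
      show "proj b y \<in> H b" using y by (intro proj_mem) (simp add: g_def)
      show "dist b (proj b y) < \<delta>" using d(2)[of b b b y] y d(1) del by (simp add: g_def)
    qed
    then have "\<phi> (- S b y) (proj b y) \<in> orb" by (rule orb_phi)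
    then show "y \<in> orb" by (simp add: proj_def)
  qed
  have bo: "b \<in> orb" using ball g by auto
  then obtain sb where sb: "b = \<phi> sb p" by (auto simp: orb_def)
  \<comment> \<open>One ball around \<open>b\<close> lies in the orbit; the flow transports it to a
    neighbourhood of every other point of the orbit.\<close>
  have "open orb"
    unfolding open_subopen[of orb]
  proof
    fix x assume "x \<in> orb"
    then obtain t where t: "x = \<phi> t p" by (auto simp: orb_def)
    let ?U = "\<phi> (sb - t) -` ball b g"
    have "continuous_on UNIV (\<lambda>y. \<phi> (sb - t) y)" by (intro continuous_intros)
    then have "open ?U" by (intro open_vimage) auto
    moreover have "x \<in> ?U" using g by (simp add: t sb)
    moreover have "?U \<subseteq> orb"
    proof
      fix y assume "y \<in> ?U"
      then have "\<phi> (sb - t) y \<in> orb" using ball by blast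
      from orb_phi[OF this, of "t - sb"] show "y \<in> orb" by simp
    qed
    ultimately show "\<exists>T. open T \<and> x \<in> T \<and> T \<subseteq> orb" by blast
  qed
  then have "orb = UNIV"
    using conn cl bo unfolding connected_clopen by auto
  then show ?thesis
    using periodic_orbit_homeomorphic_circle[OF p(2,1)] by (simp add: orb_def)
qed

end

subsection \<open>Stable points\<close>

text \<open>The section time \<open>R\<close> is continuous on \<open>D\<close> because its preimage
  of a closed set is the projection of a compact set: closedness of the graph of \<open>H\<close>
  gives compactness, and uniqueness identifies the projected times with \<open>R\<close>. It is then
  extended to all pairs and clipped to satisfy \<open>S_bound\<close>.\<close>

lemma section_flow_exists:
  fixes \<phi> :: "real \<Rightarrow> 'a::metric_space \<Rightarrow> 'a"
  assumes comp: "compact (UNIV :: 'a set)" and flow: "continuous_flow \<phi>"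
    and field: "field_of_sections \<phi> H" and graph: "closed_graph_field H"
  obtains S \<tau> r0 \<rho> where "section_flow \<phi> H S \<tau> r0 \<rho>"
proof -
  have self: "x \<in> H x" for x using field by (simp add: field_of_sections_def)
  obtain \<tau>0 r where tr: "0 < \<tau>0" "0 < r"
    and inj: "\<And>x. inj_on (\<lambda>(t, y). \<phi> t y) ({-\<tau>0..\<tau>0} \<times> H x)"
    and cov: "\<And>x. cball x r \<subseteq> (\<lambda>(t, y). \<phi> t y) ` ({-\<tau>0..\<tau>0} \<times> H x)"
    using field unfolding field_of_sections_def by blast
  have phi0: "\<phi> 0 x = x" and phi_add: "\<phi> s (\<phi> t x) = \<phi> (s + t) x" for x s t
    using flow by (simp_all add: continuous_flow_def)
  have cphi: "continuous_on UNIV (\<lambda>(t, x). \<phi> t x)" using flow by (simp add: continuous_flow_def)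
  have uniq: "e = 0" if "v \<in> H x" "\<phi> e v \<in> H x" "\<bar>e\<bar> \<le> \<tau>0" for x v e
  proof -
    have "(e, v) = (0, \<phi> e v)"
      by (rule inj_onD[OF inj[of x]]) (use that tr phi0 in \<open>auto simp: abs_le_iff\<close>)
    then show ?thesis by simp
  qed
  have ex: "\<exists>s. \<bar>s\<bar> \<le> \<tau>0 \<and> \<phi> s y \<in> H x" if "dist x y \<le> r" for x y
  proof -
    have "y \<in> cball x r" using that by simp
    then obtain t z where "\<bar>t\<bar> \<le> \<tau>0" "z \<in> H x" "y = \<phi> t z"
      using cov[of x] by (force simp: abs_le_iff)
    then show ?thesis by (intro exI[of _ "- t"]) (simp add: phi_add phi0)
  qed
  have ex1: "s = s'" if "\<bar>s\<bar> \<le> \<tau>0" "\<phi> s y \<in> H x" "\<bar>s'\<bar> \<le> \<tau>0" "\<phi> s' y \<in> H x" for x y s s'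
  proof -
    have "(- s, \<phi> s y) = (- s', \<phi> s' y)"
      by (rule inj_onD[OF inj[of x]]) (use that in \<open>auto simp: phi_add phi0 abs_le_iff\<close>)
    then show ?thesis by simp
  qed
  define D where "D = {p :: 'a \<times> 'a. dist (fst p) (snd p) \<le> r}"
  define R where "R p = (SOME s. \<bar>s\<bar> \<le> \<tau>0 \<and> \<phi> s (snd p) \<in> H (fst p))" for p
  have R: "\<bar>R p\<bar> \<le> \<tau>0" "\<phi> (R p) (snd p) \<in> H (fst p)" if "p \<in> D" for p
    using someI_ex[OF ex[of "fst p" "snd p"]] that by (simp_all add: R_def D_def)
  have clD: "closed D" unfolding D_def by (intro closed_Collect_le continuous_intros)
  have comp2: "compact (UNIV :: ('a \<times> 'a) set)" using compact_Times[OF comp comp] by simp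
  then have compD: "compact D" using compact_Int_closed[OF _ clD] by fastforce
  have "continuous_on D R"
    unfolding continuous_on_closed_vimage[OF clD]
  proof (intro allI impI)
    fix B :: "real set" assume B: "closed B"
    let ?g = "\<lambda>q :: ('a \<times> 'a) \<times> real. (fst (fst q), \<phi> (snd q) (snd (fst q)))"
    let ?K = "(D \<times> ({-\<tau>0..\<tau>0} \<inter> B)) \<inter> ?g -` {(x, y). y \<in> H x}"
    have "continuous_on UNIV (\<lambda>q :: ('a \<times> 'a) \<times> real. (snd q, snd (fst q)))"
      by (intro continuous_intros)
    from continuous_on_compose2[OF cphi this]
    have "continuous_on UNIV (\<lambda>q :: ('a \<times> 'a) \<times> real. \<phi> (snd q) (snd (fst q)))" by simp
    then have "continuous_on UNIV ?g" by (intro continuous_intros)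
    moreover have "closed {(x, y). y \<in> H x}" using graph by (simp add: closed_graph_field_def)
    ultimately have "closed (?g -` {(x, y). y \<in> H x})" by (intro closed_vimage)
    then have "compact ?K"
      using compD B by (intro compact_Int_closed compact_Times) auto
    then have "compact (fst ` ?K)" by (intro compact_continuous_image continuous_intros)
    moreover have "R -` B \<inter> D = fst ` ?K"
    proof (intro equalityI subsetI)
      fix p assume "p \<in> R -` B \<inter> D"
      then have "(p, R p) \<in> ?K" using R[of p] by (auto simp: abs_le_iff)
      then show "p \<in> fst ` ?K" by force
    next
      fix p assume "p \<in> fst ` ?K"
      then obtain s where s: "p \<in> D" "s \<in> {-\<tau>0..\<tau>0}" "s \<in> B" "\<phi> s (snd p) \<in> H (fst p)"
        by auto
      then have "\<bar>s\<bar> \<le> \<tau>0" by (simp add: abs_le_iff)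
      then have "R p = s" using R[OF s(1)] s(4) ex1 by blast
      then show "p \<in> R -` B \<inter> D" using s by simp
    qed
    ultimately show "closed (R -` B \<inter> D)" using compact_imp_closed by simp
  qed
  \<comment> \<open>\<open>R\<close> is a junk value off \<open>D\<close>, so it is cut off before the boundary of \<open>D\<close> is reached.\<close>
  define c where "c p = max 0 (min 1 (2 - 2 * dist (fst p) (snd p) / r))" for p :: "'a \<times> 'a"
  define S0 where "S0 p = (if p \<in> D then c p * R p else 0)" for p
  have "continuous_on (D \<union> {p. r \<le> dist (fst p) (snd p)}) S0"
    unfolding S0_def
  proof (rule continuous_on_If)
    show "closed {p :: 'a \<times> 'a. r \<le> dist (fst p) (snd p)}"
      by (intro closed_Collect_le continuous_intros)
    show "continuous_on D (\<lambda>p. c p * R p)"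
      unfolding c_def using tr by (intro continuous_intros \<open>continuous_on D R\<close>) auto
    show "c p * R p = 0" if "p \<in> {p. r \<le> dist (fst p) (snd p)}" "p \<in> D" for p
      using that tr by (auto simp: c_def D_def)
  qed (use clD in \<open>auto simp: D_def\<close>)
  moreover have "D \<union> {p. r \<le> dist (fst p) (snd p)} = UNIV" by (auto simp: D_def)
  ultimately have contS0: "continuous_on UNIV S0" by simp
  have S0_R: "S0 p = R p" if "dist (fst p) (snd p) \<le> r/2" for p
  proof -
    have "c p = 1" using that tr by (simp add: c_def field_simps)
    then show ?thesis using that tr by (simp add: S0_def D_def)
  qed
  have R_diag: "R (x, x) = 0" for x
    using R[of "(x, x)"] ex1[of "R (x, x)" x x 0] tr self[of x] by (simp add: D_def phi0)
  define \<tau> where "\<tau> = min \<tau>0 (1/2)"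
  have tau: "0 < \<tau>" "\<tau> \<le> 1/2" "\<tau> \<le> \<tau>0" using tr by (auto simp: \<tau>_def)
  have "uniformly_continuous_on UNIV S0" using contS0 comp2 by (rule compact_uniformly_continuous)
  then obtain d where d: "0 < d" "\<And>p q. dist q p < d \<Longrightarrow> dist (S0 q) (S0 p) < \<tau>/4"
    using tau(1) unfolding uniformly_continuous_on_def by (metis UNIV_I divide_pos_pos zero_less_numeral)
  \<comment> \<open>Within \<open>d\<close> of the diagonal, where \<open>S0\<close> vanishes, its
    size is below \<open>\<tau>/4\<close> and clipping has no effect; within \<open>r/2\<close> the
    cut-off equals \<open>1\<close>.\<close>
  define r0 where "r0 = min (d/2) (r/2)"
  have r0: "0 < r0" "r0 < d" "r0 \<le> r/2" using d tr by (auto simp: r0_def)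
  define S where "S x y = max (- (\<tau>/4)) (min (\<tau>/4) (S0 (x, y)))" for x y
  have S_R: "S x y = R (x, y)" if "dist x y \<le> r0" for x y
  proof -
    have "dist (S0 (x, y)) (S0 (x, x)) < \<tau>/4"
      using that r0 by (intro d(2)) (simp add: dist_Pair_Pair dist_commute)
    then have "\<bar>S0 (x, y)\<bar> < \<tau>/4" using S0_R[of "(x, x)"] R_diag tr by (simp add: dist_real_def)
    then show ?thesis using S0_R[of "(x, y)"] that r0 by (simp add: S_def)
  qed
  have cphi_t: "continuous_on UNIV (\<phi> t)" for t
  proof -
    have "continuous_on UNIV (\<lambda>x :: 'a. (t, x))" by (intro continuous_intros)
    from continuous_on_compose2[OF cphi this] show ?thesis by simp
  qed
  have ucphi: "\<exists>\<rho>>0. \<forall>v w. dist v w \<le> \<rho> \<longrightarrow> dist (\<phi> t v) (\<phi> t w) \<le> r0/2" for t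
  proof -
    have "uniformly_continuous_on UNIV (\<phi> t)" using cphi_t comp by (rule compact_uniformly_continuous)
    then obtain e where e: "0 < e" "\<And>v w. dist w v < e \<Longrightarrow> dist (\<phi> t w) (\<phi> t v) < r0/2"
      using r0(1) unfolding uniformly_continuous_on_def by (metis UNIV_I half_gt_zero)
    show ?thesis
    proof (intro exI conjI allI impI)
      show "0 < e/2" using e by simp
      show "dist (\<phi> t v) (\<phi> t w) \<le> r0/2" if "dist v w \<le> e/2" for v w
        using e(2)[of v w] e(1) that by simp
    qed
  qed
  obtain \<rho>p where \<rho>p: "0 < \<rho>p" "\<And>v w. dist v w \<le> \<rho>p \<Longrightarrow> dist (\<phi> 1 v) (\<phi> 1 w) \<le> r0/2"
    using ucphi[of 1] by blast
  obtain \<rho>m where \<rho>m: "0 < \<rho>m" "\<And>v w. dist v w \<le> \<rho>m \<Longrightarrow> dist (\<phi> (-1) v) (\<phi> (-1) w) \<le> r0/2"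
    using ucphi[of "-1"] by blast
  have "section_flow \<phi> H S \<tau> r0 (min r0 (min \<rho>p \<rho>m))"
  proof
    show "continuous_on UNIV (\<lambda>(x, y). S x y)"
      unfolding S_def case_prod_unfold using contS0
      by (intro continuous_intros) simp
    show "\<bar>S x y\<bar> \<le> \<tau>/4" for x y using tau(1) by (simp add: S_def abs_le_iff)
    show "\<phi> (S x y) y \<in> H x" if "dist x y \<le> r0" for x y
      using R(2)[of "(x, y)"] that r0 tr by (simp add: S_R D_def)
    show "e = 0" if "v \<in> H x" "\<phi> e v \<in> H x" "\<bar>e\<bar> \<le> \<tau>" for x v e
      using uniq[OF that(1,2)] that(3) tau(3) by simp
    show "dist (\<phi> d' v) (\<phi> d' w) \<le> r0/2" if "dist v w \<le> min r0 (min \<rho>p \<rho>m)" "d' \<in> {1, -1}" for v w d'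
      using that \<rho>p(2) \<rho>m(2) by auto
  qed (use comp flow graph self tau r0 \<rho>p \<rho>m in auto)
  then show ?thesis by (rule that)
qed

section \<open>From reparametrised stability to the holonomy\<close>

context expansive_section_flow begin

text \<open>The reparametrisation \<open>h\<close> in the stable set must agree with the hit times
  at integers. It cannot skip to another hit of the section, because it is continuous and starts at
  the right one.\<close>

lemma stable_point_imp_stab:
  assumes "stable_point \<phi> H x"
  shows "stab (\<lambda>j. \<phi> (of_int j) x)"
proof -
  let ?u = "\<lambda>j :: int. \<phi> (of_int j) x"
  obtain \<epsilon>0 where e0: "0 < \<epsilon>0"
    "\<And>s s' v w. \<lbrakk>\<bar>s\<bar> \<le> 2; \<bar>s'\<bar> \<le> 2; \<bar>s - s'\<bar> \<le> \<epsilon>0; dist v w \<le> \<epsilon>0\<rbrakk> \<Longrightarrow> dist (\<phi> s v) (\<phi> s' w) \<le> r0"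
    using phi_uniform[OF r0] by blast
  have "\<exists>\<delta>>0. \<forall>w\<in>H (?u 0). dist (?u 0) w \<le> \<delta> \<longrightarrow> (\<forall>n. dist (?u (int n)) (pt 1 ?u n w) \<le> \<epsilon>)"
    if e: "0 < \<epsilon>" for \<epsilon>
  proof -
    have "0 < min \<epsilon> \<epsilon>0" using e e0 by simp
    then obtain \<delta> where del: "0 < \<delta>" "local_section H \<delta> x \<subseteq> stable_set \<phi> H (min \<epsilon> \<epsilon>0) x"
      using assms unfolding stable_point_def by blast
    have "dist (?u (int n)) (pt 1 ?u n w) \<le> \<epsilon>" if w: "w \<in> H x" "dist x w \<le> \<delta>" for w n
    proof -
      have "w \<in> stable_set \<phi> H (min \<epsilon> \<epsilon>0) x" using w del(2) by (auto simp: local_section_def)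
      then obtain h where "h \<in> Rep"
        and "\<forall>t\<ge>0. \<phi> (restrict h {0..} t) w \<in> local_section H (min \<epsilon> \<epsilon>0) (\<phi> t x)"
        unfolding stable_set_def Rep_plus_def by auto
      then have h0: "h 0 = 0" and hc: "continuous_on UNIV h"
        and hH: "\<And>t. 0 \<le> t \<Longrightarrow> \<phi> (h t) w \<in> H (\<phi> t x)"
        and hd: "\<And>t. 0 \<le> t \<Longrightarrow> dist (\<phi> t x) (\<phi> (h t) w) \<le> min \<epsilon> \<epsilon>0"
        by (auto simp: Rep_def homeomorphism_def local_section_def)
      have "hol 1 ?u n w = h (real n)"
      proof (induction n)
        case (Suc n)
        define y where "y = \<phi> (h (real n)) w"
        define v where "v = \<phi> (real n) x"
        \<comment> \<open>The discrepancy between \<open>h\<close> and the section time, followed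
          continuously from \<open>n\<close> to \<open>n + 1\<close>.\<close>
        define f where "f s = h (real n + s) - (h (real n) + s + S (\<phi> s v) (\<phi> s y))" for s
        have vy: "dist v y \<le> \<epsilon>0" "y \<in> H v"
          using hd[of "real n"] hH[of "real n"] by (auto simp: y_def v_def)
        have clo: "dist (\<phi> s v) (\<phi> s y) \<le> r0" if "0 \<le> s" "s \<le> 1" for s
          using that vy(1) e0(1) by (intro e0(2)) auto
        have f0: "f 0 = 0" using S_eq_0[OF vy(2)] clo[of 0] by (simp add: f_def)
        have fz: "f s = 0" if s: "0 \<le> s" "s \<le> 1" "\<bar>f s\<bar> \<le> \<tau>" for s
        proof (rule unique[OF proj_mem[OF clo[OF s(1,2)]] _ s(3)])
          have "\<phi> (f s) (proj (\<phi> s v) (\<phi> s y)) = \<phi> (h (real n + s)) w"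
            by (simp add: proj_def f_def y_def)
          then show "\<phi> (f s) (proj (\<phi> s v) (\<phi> s y)) \<in> H (\<phi> s v)"
            using hH[of "real n + s"] s(1) by (simp add: v_def add.commute)
        qed
        have "continuous_on {0..1} (\<lambda>s. \<bar>f s\<bar>)"
          unfolding f_def
          by (intro continuous_intros continuous_on_compose2[OF hc]) auto
        \<comment> \<open>If \<open>\<bar>f\<bar>\<close> exceeded \<open>\<tau>\<close>, it would
          take the value \<open>\<tau>\<close> on the way; but \<open>fz\<close> makes
          \<open>f\<close> vanish wherever its size is at most \<open>\<tau>\<close>.\<close>
        then have "\<bar>f 1\<bar> \<le> \<tau>"
          using IVT'[of "\<lambda>s. \<bar>f s\<bar>" 0 \<tau> 1] f0 fz tau(1) by (smt (verit))
        then have "f 1 = 0" by (intro fz) auto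
        then have "h (real n + 1) = h (real n) + 1 + S (\<phi> 1 v) (\<phi> 1 y)" by (simp add: f_def)
        then show ?case unfolding hol_Suc pt_def Suc by (simp add: v_def y_def add.commute)
      qed (simp add: h0)
      then show ?thesis using hd[of "real n"] by (simp add: pt_def)
    qed
    then show ?thesis using del(1) by auto
  qed
  moreover have "pseudo (r0/2) ?u" using r0 by (intro pseudo_orbit) (auto simp: add.commute)
  ultimately show ?thesis unfolding stab_def by (auto simp: add.commute)
qed

end

lemma no_stable_points:
  fixes \<phi> :: "real \<Rightarrow> 'a::metric_space \<Rightarrow> 'a"
  assumes peano: "peano_continuum (UNIV :: 'a set)"
    and circle: "\<not> (UNIV :: 'a set) homeomorphic sphere (0::complex) 1"
    and flow: "continuous_flow \<phi>" "field_of_sections \<phi> H" "closed_graph_field H"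
    and cw: "cw_expansive \<phi>"
  shows "\<nexists>x. stable_point \<phi> H x"
proof
  assume "\<exists>x. stable_point \<phi> H x"
  then obtain x where x: "stable_point \<phi> H x" by blast
  have comp: "compact (UNIV :: 'a set)" and conn: "connected (UNIV :: 'a set)"
    and loc: "locally connected (UNIV :: 'a set)"
    using peano by (auto simp: peano_continuum_def continuum_def)
  obtain S \<tau> r0 \<rho> where "section_flow \<phi> H S \<tau> r0 \<rho>"
    using section_flow_exists[OF comp flow] by blast
  then interpret section_flow \<phi> H S \<tau> r0 \<rho> .
  show False
  proof (rule shadowing_continuum_trivial[OF cw])
    fix \<rho>1 assume rho1: "0 < \<rho>1" "\<rho>1 \<le> \<rho>"
      and triv: "\<And>u A x y. \<lbrakk>continuum A; A \<subseteq> H (u 0);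
         \<And>z d n. \<lbrakk>z \<in> A; d \<in> {1, -1}\<rbrakk> \<Longrightarrow> dist (u (d * int n)) (pt d u n z) \<le> \<rho>1; x \<in> A; y \<in> A\<rbrakk>
         \<Longrightarrow> x = y"
    have "expansive_section_flow \<phi> H S \<tau> r0 \<rho> \<rho>1"
      by unfold_locales (fact rho1 loc triv)+
    then interpret expansive_section_flow \<phi> H S \<tau> r0 \<rho> \<rho>1 .
    show False
      using stab_imp_circle[OF stable_point_imp_stab[OF x] conn] circle by blast
  qed
qed

section \<open>Reversal of time\<close>

lemma continuous_flow_reverse:
  assumes "continuous_flow \<phi>"
  shows "continuous_flow (\<lambda>t. \<phi> (- t))"
proof -
  have "continuous_on UNIV (\<lambda>(t, x). \<phi> t x)" using assms by (simp add: continuous_flow_def)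
  then have "continuous_on UNIV (\<lambda>p. case (- fst p, snd p) of (t, x) \<Rightarrow> \<phi> t x)"
    by (rule continuous_on_compose2) (auto intro!: continuous_intros)
  moreover have "\<phi> (- (s + t)) x = \<phi> (- s) (\<phi> (- t) x)" for s t x
    using assms unfolding continuous_flow_def minus_add_distrib by blast
  ultimately show ?thesis using assms unfolding continuous_flow_def case_prod_unfold by simp
qed

text \<open>The time interval is symmetric about \<open>0\<close>, so negation permutes it and the
  flow boxes are unchanged.\<close>

lemma field_of_sections_reverse:
  assumes "field_of_sections \<phi> H"
  shows "field_of_sections (\<lambda>t. \<phi> (- t)) H"
proof -
  have inj: "inj_on (\<lambda>(t, y). \<phi> (- t) y) ({-\<tau>..\<tau>} \<times> A)"
    if "inj_on (\<lambda>(t, y). \<phi> t y) ({-\<tau>..\<tau>} \<times> A)" for \<tau> A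
  proof (rule inj_onI, clarify)
    fix s x t y assume *: "s \<in> {-\<tau>..\<tau>}" "t \<in> {-\<tau>..\<tau>}" "x \<in> A" "y \<in> A" "\<phi> (- s) x = \<phi> (- t) y"
    have "(- s, x) = (- t, y)" by (rule inj_onD[OF that]) (use * in auto)
    then show "s = t \<and> x = y" by simp
  qed
  have img: "(\<lambda>(t, y). \<phi> (- t) y) ` ({-\<tau>..\<tau>} \<times> A) = (\<lambda>(t, y). \<phi> t y) ` ({-\<tau>..\<tau>} \<times> A)" for \<tau> A
  proof (intro equalityI subsetI)
    fix z assume "z \<in> (\<lambda>(t, y). \<phi> (- t) y) ` ({-\<tau>..\<tau>} \<times> A)"
    then obtain t y where "t \<in> {-\<tau>..\<tau>}" "y \<in> A" "z = \<phi> (- t) y" by auto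
    then show "z \<in> (\<lambda>(t, y). \<phi> t y) ` ({-\<tau>..\<tau>} \<times> A)"
      by (intro image_eqI[of _ _ "(- t, y)"]) auto
  next
    fix z assume "z \<in> (\<lambda>(t, y). \<phi> t y) ` ({-\<tau>..\<tau>} \<times> A)"
    then obtain t y where "t \<in> {-\<tau>..\<tau>}" "y \<in> A" "z = \<phi> t y" by auto
    then show "z \<in> (\<lambda>(t, y). \<phi> (- t) y) ` ({-\<tau>..\<tau>} \<times> A)"
      by (intro image_eqI[of _ _ "(- t, y)"]) auto
  qed
  show ?thesis
    using assms inj unfolding field_of_sections_def img by meson
qed

lemma cw_expansive_reverse:
  assumes "cw_expansive \<phi>"
  shows "cw_expansive (\<lambda>t. \<phi> (- t))"
  unfolding cw_expansive_def
proof (intro allI impI)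
  fix \<eta> :: real assume "0 < \<eta>"
  then obtain \<delta> where del: "0 < \<delta>" "\<And>A \<alpha> x. \<lbrakk>\<alpha> \<in> time_changes A; x \<in> A; continuum A; \<alpha> x = id;
      \<forall>t. diameter (moved_set \<phi> \<alpha> t A) \<le> \<delta>\<rbrakk> \<Longrightarrow> A \<subseteq> (\<lambda>t. \<phi> t x) ` {-\<eta><..<\<eta>}"
    using assms unfolding cw_expansive_def by meson
  show "\<exists>\<delta>>0. \<forall>A. \<forall>\<alpha>\<in>time_changes A. \<forall>x\<in>A.
      continuum A \<and> \<alpha> x = id \<and> (\<forall>t. diameter (moved_set (\<lambda>t. \<phi> (- t)) \<alpha> t A) \<le> \<delta>)
      \<longrightarrow> A \<subseteq> (\<lambda>t. \<phi> (- t) x) ` {-\<eta><..<\<eta>}"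
  proof (intro exI[of _ \<delta>] conjI allI ballI impI del(1), elim conjE)
    fix A \<alpha> x assume a: "\<alpha> \<in> time_changes A" "x \<in> A" "continuum A" "\<alpha> x = id"
      "\<forall>t. diameter (moved_set (\<lambda>t. \<phi> (- t)) \<alpha> t A) \<le> \<delta>"
    \<comment> \<open>Negating inside and outside keeps the identity at \<open>x\<close> and matches
      the moved set of \<open>\<phi>\<close> at \<open>t\<close> with that of the reversed flow at
      \<open>- t\<close>.\<close>
    define \<beta> where "\<beta> y t = - \<alpha> y (- t)" for y t
    have bx: "\<beta> x = id" using a(4) by (auto simp: \<beta>_def)
    have tc: "\<And>y. y \<in> A \<Longrightarrow> continuous_on UNIV (\<alpha> y)" "\<And>y. y \<in> A \<Longrightarrow> \<alpha> y 0 = 0"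
      "\<And>t. continuous_on A (\<lambda>y. \<alpha> y t)"
      using a(1) by (auto simp: time_changes_def)
    have "continuous_on UNIV (\<beta> y)" if "y \<in> A" for y
      unfolding \<beta>_def[abs_def]
      by (intro continuous_intros continuous_on_compose2[OF tc(1)[OF that]]) auto
    then have "\<beta> \<in> time_changes A"
      using bx a(2) tc(2,3) by (auto simp: time_changes_def \<beta>_def intro: continuous_on_minus)
    moreover have "moved_set \<phi> \<beta> t A = moved_set (\<lambda>t. \<phi> (- t)) \<alpha> (- t) A" for t
      by (simp add: moved_set_def \<beta>_def)
    then have "\<forall>t. diameter (moved_set \<phi> \<beta> t A) \<le> \<delta>" using a(5) by simp
    ultimately have "A \<subseteq> (\<lambda>t. \<phi> t x) ` {-\<eta><..<\<eta>}"
      using a(2,3) bx by (intro del(2)[of \<beta>])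
    also have "\<dots> \<subseteq> (\<lambda>t. \<phi> (- t) x) ` {-\<eta><..<\<eta>}"
    proof
      fix z assume "z \<in> (\<lambda>t. \<phi> t x) ` {-\<eta><..<\<eta>}"
      then obtain t where "t \<in> {-\<eta><..<\<eta>}" "z = \<phi> t x" by auto
      then show "z \<in> (\<lambda>t. \<phi> (- t) x) ` {-\<eta><..<\<eta>}" by (intro image_eqI[of _ _ "- t"]) auto
    qed
    finally show "A \<subseteq> (\<lambda>t. \<phi> (- t) x) ` {-\<eta><..<\<eta>}" .
  qed
qed

lemma Rep_reverse:
  assumes "h \<in> Rep"
  shows "(\<lambda>t. - h (- t)) \<in> Rep"
proof -
  obtain g where g: "homeomorphism UNIV UNIV h g" using assms by (auto simp: Rep_def)
  have "homeomorphism UNIV UNIV (\<lambda>t. - h (- t)) (\<lambda>t. - g (- t))"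
  proof (rule homeomorphismI)
    have "continuous_on UNIV h" "continuous_on UNIV g" using g by (auto simp: homeomorphism_def)
    then have "continuous_on UNIV (\<lambda>t. h (- t))" "continuous_on UNIV (\<lambda>t. g (- t))"
      by (auto elim!: continuous_on_compose2 intro: continuous_on_minus continuous_on_id)
    then show "continuous_on UNIV (\<lambda>t. - h (- t))" "continuous_on UNIV (\<lambda>t. - g (- t))"
      by (auto intro: continuous_on_minus)
  qed (use g in \<open>auto simp: homeomorphism_def\<close>)
  then show ?thesis using assms by (auto simp: Rep_def strict_mono_def)
qed

lemma stable_point_reverse:
  assumes "reverse_stable_point \<phi> H x"
  shows "stable_point (\<lambda>t. \<phi> (- t)) H x"
proof -
  have "unstable_set \<phi> H \<epsilon> x \<subseteq> stable_set (\<lambda>t. \<phi> (- t)) H \<epsilon> x" for \<epsilon>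
  proof
    fix y assume "y \<in> unstable_set \<phi> H \<epsilon> x"
    then obtain h where h: "h \<in> Rep" "\<forall>t\<le>0. \<phi> (restrict h {..0} t) y \<in> local_section H \<epsilon> (\<phi> t x)"
      by (auto simp: unstable_set_def Rep_minus_def)
    let ?k = "restrict (\<lambda>t. - h (- t)) {0..}"
    have "?k \<in> Rep_plus" unfolding Rep_plus_def using Rep_reverse[OF h(1)] by (rule imageI)
    moreover have "\<phi> (- ?k t) y \<in> local_section H \<epsilon> (\<phi> (- t) x)" if "0 \<le> t" for t
      using h(2)[rule_format, of "- t"] that by simp
    ultimately show "y \<in> stable_set (\<lambda>t. \<phi> (- t)) H \<epsilon> x"
      unfolding stable_set_def by blast
  qed
  then show ?thesis using assms unfolding reverse_stable_point_def stable_point_def by (meson order_trans)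
qed

theorem theorem5p8:
  fixes \<phi> :: "real \<Rightarrow> 'a::metric_space \<Rightarrow> 'a"
    and H :: "'a \<Rightarrow> 'a set"
  assumes "peano_continuum (UNIV :: 'a set)"
    and "\<not> (UNIV :: 'a set) homeomorphic sphere (0::complex) 1"
    and "continuous_flow \<phi>"
    and "no_fixed_points \<phi>"
    and "field_of_sections \<phi> H"
    and "symmetric_field H"
    and "monotone_field \<phi> H"
    and "closed_graph_field H"
    and "cw_expansive \<phi>"
  shows "(\<nexists>x. stable_point \<phi> H x) \<and> (\<nexists>x. reverse_stable_point \<phi> H x)"
proof
  show "\<nexists>x. stable_point \<phi> H x"
    using assms by (intro no_stable_points)
  have "\<nexists>x. stable_point (\<lambda>t. \<phi> (- t)) H x"
    using assms by (intro no_stable_points continuous_flow_reverse field_of_sections_reverse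
        cw_expansive_reverse)
  then show "\<nexists>x. reverse_stable_point \<phi> H x"
    using stable_point_reverse by blast
qed

end
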